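(* For every fixed integer $k\ge1$ there is a polynomial $p_k$ of degree $k$ with leading term $\big(\tfrac{6}{\pi^2}\big)^k(\log n)^k$ such that, as $n\to\infty$, \[ \mathbb{E}[D_n^k]=p_k(\log n)+O\Big(\frac{\log^{k-1}n}{n}\Big). \]
   Context: $D_n$ is the absorption time at state 1 of the continuous-time Markov chain on $\{1,2,\dots\}$ started at $n$ that jumps from $m$ to $i$ at rate $1/(m-i)$ for $1\le i\le m-1$ (equivalently, the height of a uniformly random leaf in the continuous-time critical beta-splitting tree $\mathrm{CTCS}(n)$). *)

theory Defs
  imports "HOL-Probability.Probability" "HOL-Computational_Algebra.Polynomial"
    "HOL-Library.Landau_Symbols"
begin

text \<open>Continuous-time chain on {1,2,...}: from state m it jumps to i (1 \<le> i \<le> m-1) at rate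
 1/(m-i). Total exit rate from m is harm (m-1). Embedded jump chain: jump to i with
 probability (1/(m-i)) / harm (m-1).\<close>

definition jump_prob :: "nat \<Rightarrow> nat \<Rightarrow> real" where
  "jump_prob m i = (if 1 \<le> i \<and> i < m then 1 / (real (m - i) * harm (m - 1)) else 0)"

definition jump :: "nat \<Rightarrow> nat pmf" where
  "jump m = embed_pmf (jump_prob m)"

lemma harm_pos_nat: "n \<ge> 1 \<Longrightarrow> (harm n :: real) > 0"
  by (simp add: harm_pos)

lemma jump_prob_sum: assumes "m \<ge> 2" shows "(\<Sum>i\<in>{1..<m}. jump_prob m i) = 1"
proof -
  have h: "harm (m-1) > (0::real)" using assms by (simp add: harm_pos)
  have "(\<Sum>i\<in>{1..<m}. jump_prob m i) = (\<Sum>i\<in>{1..<m}. 1 / real (m - i)) / harm (m-1)"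
    by (simp add: jump_prob_def sum_divide_distrib)
  also have "(\<Sum>i\<in>{1..<m}. 1 / real (m - i)) = (\<Sum>j\<in>{1..m-1}. 1 / real j)"
    by (rule sum.reindex_bij_witness[where i="\<lambda>j. m - j" and j="\<lambda>i. m - i"]) auto
  also have "\<dots> = harm (m-1)" by (simp add: harm_def inverse_eq_divide)
  finally show ?thesis using h by (metis divide_self less_irrefl)
qed

lemma jump_valid_nonneg: "0 \<le> jump_prob m x"
  by (cases "m \<ge> 2") (auto simp: jump_prob_def harm_nonneg)

lemma jump_valid:
  assumes "m \<ge> 2"
  shows "\<And>x. 0 \<le> jump_prob m x"
    and "(\<integral>\<^sup>+ x. ennreal (jump_prob m x) \<partial>count_space UNIV) = 1"
proof -
  show "\<And>x. 0 \<le> jump_prob m x" by (rule jump_valid_nonneg)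
  have "(\<integral>\<^sup>+ x. ennreal (jump_prob m x) \<partial>count_space UNIV)
        = (\<Sum>x\<in>{1..<m}. ennreal (jump_prob m x))"
    by (rule nn_integral_count_space') (auto simp: jump_prob_def)
  also have "\<dots> = ennreal (\<Sum>x\<in>{1..<m}. jump_prob m x)"
    by (rule sum_ennreal) (use jump_valid_nonneg in auto)
  finally show "(\<integral>\<^sup>+ x. ennreal (jump_prob m x) \<partial>count_space UNIV) = 1"
    using jump_prob_sum[OF assms] by simp
qed

lemma set_pmf_jump: assumes "m \<ge> 2" and "i \<in> set_pmf (jump m)" shows "i < m"
proof -
  have "pmf (jump m) i \<noteq> 0" using assms(2) by (simp add: set_pmf_eq)
  then have "jump_prob m i \<noteq> 0"
    unfolding jump_def using pmf_embed_pmf[OF jump_valid[OF assms(1)]] by simp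
  then show ?thesis by (simp add: jump_prob_def split: if_splits)
qed

function jpath :: "nat \<Rightarrow> nat list pmf" where
  "jpath m = (if m \<le> 1 then return_pmf []
              else bind_pmf (jump m) (\<lambda>i. map_pmf (Cons m) (jpath i)))"
  by auto
termination
  by (relation "Wellfounded.measure id") (auto intro: set_pmf_jump)

definition holding_law :: "nat list \<Rightarrow> real measure" where
  "holding_law p = foldr (\<lambda>m M. density lborel (exponential_density (harm (m - 1))) \<star> M)
                      p (return borel 0)"

text \<open>Law of D_n, the absorption time at 1 started from n.\<close>
definition D_law :: "nat \<Rightarrow> real measure" where
  "D_law n = measure_pmf (jpath n) \<bind> holding_law"

definition D_moment :: "nat \<Rightarrow> nat \<Rightarrow> real" where
  "D_moment n k = (\<integral>x. x ^ k \<partial>D_law n)"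

end

theory Submission
  imports Defs
begin

text \<open>
  The moments satisfy \<open>\<Sum>i<m. (E[D_m^k] - E[D_i^k]) / (m - i) = k E[D_m^(k-1)]\<close>, and
  \<open>m \<mapsto> binomial (m - 1) j\<close> is an eigenvector of the operator on the left with eigenvalue
  \<open>h_j = 1 + 1/2 + \<dots> + 1/j\<close>. Hence \<open>E[D_n^k] = k! \<Sum>j\<ge>1. (-1)^(j-1) binomial (n - 1) j / h_j^k\<close>.

  Interpolated to real \<open>s\<close>, \<open>h_s = \<Sum>j. s / (j (j + s))\<close>. Truncating the series gives a rational
  function whose zeros interlace with its poles, so its reciprocal is \<open>a/s\<close> plus a positive combination
  of a constant and functions \<open>1 / (s + \<rho>)\<close> with \<open>\<rho> > 1\<close>. In the limit \<open>1/h_s = a/s + R(s)\<close> with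
  \<open>a = 6/\<pi>\<^sup>2\<close> and \<open>R(-1), R(0), R(1), \<dots>\<close> completely monotone. Products and divided differences at
  \<open>s = 0\<close> preserve this property, so \<open>1/h_s^k\<close> is a polynomial of degree \<open>k\<close> in \<open>1/s\<close> plus a
  difference of completely monotone sequences starting at \<open>s = -1\<close>.

  The alternating binomial sum of such a sequence is a constant plus \<open>O(1/n)\<close>: this is where
  \<open>s = -1\<close> is needed. That of \<open>1/s^r\<close> is the complete homogeneous symmetric polynomial of degree
  \<open>r\<close> in \<open>1, 1/2, \<dots>, 1/(n-1)\<close>, which Newton's identities express through power sums, and only
  the first power sum grows, like \<open>ln n\<close>.
\<close>

section \<open>Completely monotone sequences\<close>

definition bdiff :: "(nat \<Rightarrow> real) \<Rightarrow> nat \<Rightarrow> real" where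
  "bdiff x = (\<lambda>m. x m - x (Suc m))"

text \<open>By Hausdorff's theorem these are the moment sequences of finite positive measures on the
  interval from 0 to 1. The arguments below work with the differences alone.\<close>

definition cm :: "(nat \<Rightarrow> real) \<Rightarrow> bool" where
  "cm x \<longleftrightarrow> (\<forall>n m. 0 \<le> (bdiff ^^ n) x m)"

lemma funpow_bdiff_Suc: "(bdiff ^^ Suc n) x m = (bdiff ^^ n) x m - (bdiff ^^ n) x (Suc m)"
  by (simp add: bdiff_def)

lemma funpow_bdiff_shift: "(bdiff ^^ n) (\<lambda>m. x (Suc m)) m = (bdiff ^^ n) x (Suc m)"
  by (induction n arbitrary: m) (simp_all add: funpow_bdiff_Suc del: funpow.simps(2))

lemma funpow_bdiff_add:
  "(bdiff ^^ n) (\<lambda>m. x m + y m) m = (bdiff ^^ n) x m + (bdiff ^^ n) y m"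
  by (induction n arbitrary: m) (simp_all add: funpow_bdiff_Suc del: funpow.simps(2))

lemma funpow_bdiff_sum_binomial:
  "(bdiff ^^ n) x m = (\<Sum>j\<le>n. real (n choose j) * (-1) ^ j * x (m + j))"
proof (induction n arbitrary: m)
  case 0
  then show ?case by simp
next
  case (Suc n)
  have "(\<Sum>j\<le>Suc n. real (Suc n choose j) * (-1) ^ j * x (m + j)) =
    x m + (\<Sum>j\<le>n. (real (n choose j) + real (n choose Suc j)) * (-1) ^ Suc j * x (m + Suc j))"
    by (subst sum.atMost_Suc_shift) simp
  also have "\<dots> = (x m + (\<Sum>j\<le>n. real (n choose Suc j) * (-1) ^ Suc j * x (m + Suc j))) +
      (\<Sum>j\<le>n. real (n choose j) * (-1) ^ Suc j * x (m + Suc j))"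
    by (simp only: distrib_right sum.distrib)
  also have "x m + (\<Sum>j\<le>n. real (n choose Suc j) * (-1) ^ Suc j * x (m + Suc j)) =
      (\<Sum>j\<le>Suc n. real (n choose j) * (-1) ^ j * x (m + j))"
    by (subst sum.atMost_Suc_shift) simp
  also have "\<dots> = (bdiff ^^ n) x m"
    by (simp add: Suc binomial_eq_0)
  also have "(\<Sum>j\<le>n. real (n choose j) * (-1) ^ Suc j * x (m + Suc j)) = - (bdiff ^^ n) x (Suc m)"
    by (simp add: Suc sum_negf)
  finally show ?case by (simp only: funpow_bdiff_Suc)
qed

lemma cm_nonneg: "cm x \<Longrightarrow> 0 \<le> x m"
  unfolding cm_def by (metis funpow_0)

lemma cm_decreasing: "cm x \<Longrightarrow> x (Suc m) \<le> x m"
  unfolding cm_def by (drule spec[of _ 1], drule spec[of _ m]) (simp add: bdiff_def)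

lemma cm_bdiff: "cm x \<Longrightarrow> cm (bdiff x)"
  unfolding cm_def by (metis funpow_Suc_right o_apply)

lemma cm_shift: "cm x \<Longrightarrow> cm (\<lambda>m. x (Suc m))"
  unfolding cm_def by (simp add: funpow_bdiff_shift)

lemma cm_add: "cm x \<Longrightarrow> cm y \<Longrightarrow> cm (\<lambda>m. x m + y m)"
  unfolding cm_def by (simp add: funpow_bdiff_add)

text \<open>Leibniz rule: the difference of \<open>x m * y m\<close> is
  \<open>bdiff x m * y m + x (Suc m) * bdiff y m\<close>. Both summands are products of completely
  monotone sequences, so induction on the order works once \<open>x\<close> and \<open>y\<close> are
  generalized.\<close>

lemma cm_mult:
  assumes "cm x" "cm y"
  shows "cm (\<lambda>m. x m * y m)"
proof -
  have "0 \<le> (bdiff ^^ n) (\<lambda>m. x m * y m) m" if "cm x" "cm y" for n m x y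
    using that
  proof (induction n arbitrary: m x y)
    case 0
    then show ?case by (simp add: cm_nonneg)
  next
    case (Suc n)
    have "bdiff (\<lambda>m. x m * y m) = (\<lambda>m. bdiff x m * y m + x (Suc m) * bdiff y m)"
      by (simp add: bdiff_def algebra_simps)
    then have "(bdiff ^^ Suc n) (\<lambda>m. x m * y m) m =
        (bdiff ^^ n) (\<lambda>m. bdiff x m * y m) m + (bdiff ^^ n) (\<lambda>m. x (Suc m) * bdiff y m) m"
      by (simp only: funpow_Suc_right o_apply funpow_bdiff_add)
    then show ?case
      using Suc.IH[OF cm_bdiff[OF Suc.prems(1)] Suc.prems(2)]
        Suc.IH[OF cm_shift[OF Suc.prems(1)] cm_bdiff[OF Suc.prems(2)]]
      by simp
  qed
  then show ?thesis using assms by (simp add: cm_def)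
qed

lemma cm_const:
  assumes "0 \<le> c"
  shows "cm (\<lambda>_. c)"
  unfolding cm_def
proof (intro allI)
  fix n m
  have "(bdiff ^^ Suc k) (\<lambda>_. c) m = 0" for k m
    by (induction k arbitrary: m)
       (simp add: bdiff_def, simp only: funpow_bdiff_Suc[of "Suc _"] diff_self)
  with assms show "0 \<le> (bdiff ^^ n) (\<lambda>_. c) m"
    by (cases n) (simp_all del: funpow.simps(2))
qed

text \<open>With \<open>t = m + c\<close>, the \<open>n\<close>-th difference has the closed form
  \<open>n! / (t (t + 1) ... (t + n))\<close>, which is visibly positive.\<close>

lemma cm_inverse:
  assumes "0 < c"
  shows "cm (\<lambda>m. 1 / (real m + c))"
proof -
  have "(bdiff ^^ n) (\<lambda>m. 1 / (real m + c)) m = fact n / pochhammer (real m + c) (Suc n)" for n m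
  proof (induction n arbitrary: m)
    case 0
    then show ?case by simp
  next
    case (Suc n)
    define t where "t = real m + c"
    define w where "w = pochhammer (t + 1) n"
    have t: "0 < t" using assms by (simp add: t_def add_nonneg_pos)
    have w: "0 < w" unfolding w_def by (rule pochhammer_pos) (use t in simp)
    have 1: "pochhammer t (Suc n) = t * w"
      by (simp add: pochhammer_rec w_def)
    have 2: "pochhammer (t + 1) (Suc n) = w * (t + 1 + real n)"
      by (simp add: pochhammer_Suc w_def)
    have 3: "pochhammer t (Suc (Suc n)) = t * w * (t + 1 + real n)"
      by (simp add: pochhammer_rec[of t "Suc n"] 2)
    have "fact n / (t * w) - fact n / (w * (t + 1 + real n)) =
        (fact (Suc n) :: real) / (t * w * (t + 1 + real n))"
      using t w by (simp add: divide_simps add_pos_pos) (simp add: algebra_simps)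
    then have "fact n / pochhammer t (Suc n) - fact n / pochhammer (t + 1) (Suc n) =
        fact (Suc n) / pochhammer t (Suc (Suc n))"
      by (simp only: 1 2 3)
    then show ?case
      unfolding funpow_bdiff_Suc Suc.IH by (simp add: t_def ac_simps)
  qed
  then show ?thesis unfolding cm_def
    using assms by (simp add: pochhammer_nonneg add_nonneg_pos)
qed

lemma cm_limit:
  assumes "\<And>N. cm (X N)" and lim: "\<And>m. (\<lambda>N. X N m) \<longlonglongrightarrow> x m"
  shows "cm x"
proof -
  have "(\<lambda>N. (bdiff ^^ n) (X N) m) \<longlonglongrightarrow> (bdiff ^^ n) x m" for n m
    by (induction n arbitrary: m) (simp_all add: funpow_bdiff_Suc lim tendsto_diff del: funpow.simps(2))
  then show ?thesis unfolding cm_def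
    using assms(1) by (meson LIMSEQ_le_const cm_def)
qed

text \<open>For a moment sequence \<open>x m = \<integral> t^m d\<mu>\<close> this is the bound \<open>t (1 - t)^n \<le> 1 / (n + 1)\<close>.\<close>
lemma cm_funpow_bdiff_le:
  assumes "cm x"
  shows "(bdiff ^^ n) x 1 \<le> x 0 / real (Suc n)"
proof -
  \<comment> \<open>The differences at index 1 decrease in their order, so the \<open>n\<close>-th
    is at most the average of the first \<open>n + 1\<close>. Their sum telescopes, because each
    difference at index 1 is the difference of two consecutive orders at index 0.\<close>
  have dec: "(bdiff ^^ Suc i) x 1 \<le> (bdiff ^^ i) x 1" for i
    using assms unfolding cm_def funpow_bdiff_Suc[of i x 1] by (simp add: numeral_2_eq_2)
  then have "(bdiff ^^ n) x 1 \<le> (bdiff ^^ i) x 1" if "i \<le> n" for i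
    using that by (rule lift_Suc_antimono_le)
  then have "(\<Sum>i\<le>n. (bdiff ^^ n) x 1) \<le> (\<Sum>i\<le>n. (bdiff ^^ i) x 1)"
    by (intro sum_mono) simp
  also have "(\<Sum>i\<le>n. (bdiff ^^ i) x 1) = x 0 - (bdiff ^^ Suc n) x 0"
    by (induction n) (simp_all add: bdiff_def)
  also have "\<dots> \<le> x 0"
    using assms by (auto simp: cm_def simp del: funpow.simps(2))
  finally show ?thesis by (simp add: field_simps)
qed

section \<open>Repeated divided differences at \<open>s = 0\<close>\<close>

text \<open>The index \<open>m\<close> of a sequence stands for the argument \<open>s = m - 1\<close> of the interpolating
  function, so \<open>z\<close> is the negated divided difference at \<open>s = 0\<close>; its value at \<open>s = 0\<close> itself
  is left unspecified.\<close>
definition divdiff :: "(nat \<Rightarrow> real) \<Rightarrow> (nat \<Rightarrow> real) \<Rightarrow> bool" where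
  "divdiff x z \<longleftrightarrow> (\<forall>m. (real m - 1) * z m = x 1 - x m)"

text \<open>Dividing a remainder by \<open>s\<close> will replace it by its divided difference, so
  complete monotonicity must survive that operation repeatedly. The counter \<open>r\<close> says
  how many more times it may be performed.\<close>

fun icm :: "nat \<Rightarrow> (nat \<Rightarrow> real) \<Rightarrow> bool" where
  "icm 0 x \<longleftrightarrow> cm x"
| "icm (Suc r) x \<longleftrightarrow> cm x \<and> (\<exists>z. icm r z \<and> divdiff x z)"

lemma icm_imp_cm: "icm r x \<Longrightarrow> cm x"
  by (cases r) auto

lemma icm_Suc_imp: "icm (Suc r) x \<Longrightarrow> icm r x"
proof (induction r arbitrary: x)
  case (Suc r)
  from Suc.prems obtain z where "cm x" "icm (Suc r) z" "divdiff x z"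
    unfolding icm.simps(2)[of "Suc r"] by blast
  with Suc.IH show ?case unfolding icm.simps(2)[of r x] by blast
qed simp

lemma icm_const: "0 \<le> c \<Longrightarrow> icm r (\<lambda>_. c)"
  by (induction r arbitrary: c) (auto simp: cm_const divdiff_def intro!: exI[of _ "\<lambda>_. 0"])

lemma icm_add: "icm r x \<Longrightarrow> icm r y \<Longrightarrow> icm r (\<lambda>m. x m + y m)"
proof (induction r arbitrary: x y)
  case (Suc r)
  from Suc.prems obtain u v where "icm r u" "divdiff x u" "icm r v" "divdiff y v" by auto
  with Suc.IH have "icm r (\<lambda>m. u m + v m)" "divdiff (\<lambda>m. x m + y m) (\<lambda>m. u m + v m)"
    by (simp_all only: divdiff_def distrib_left) simp
  with Suc.prems show ?case by (auto simp: cm_add)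
qed (simp add: cm_add)

text \<open>Product rule for divided differences: \<open>x 1 * y 1 - x m * y m\<close> equals
  \<open>x 1 * (y 1 - y m) + y m * (x 1 - x m)\<close>. The witness again consists of sums and
  products of nonnegative constants and \<open>icm r\<close> sequences.\<close>

lemma icm_mult: "icm r x \<Longrightarrow> icm r y \<Longrightarrow> icm r (\<lambda>m. x m * y m)"
proof (induction r arbitrary: x y)
  case (Suc r)
  from Suc.prems obtain u v where u: "icm r u" "divdiff x u" and v: "icm r v" "divdiff y v"
    by auto
  have "0 \<le> x 1" by (rule cm_nonneg[OF icm_imp_cm[OF Suc.prems(1)]])
  then have "icm r (\<lambda>m. x 1 * v m + y m * u m)"
    by (intro icm_add Suc.IH[OF icm_const v(1)] Suc.IH[OF icm_Suc_imp[OF Suc.prems(2)] u(1)])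
  moreover have "(real m - 1) * (x 1 * v m + y m * u m) = x 1 * y 1 - x m * y m" for m
    using u(2)[unfolded divdiff_def, rule_format, of m] v(2)[unfolded divdiff_def, rule_format, of m]
    by algebra
  ultimately show ?case using Suc.prems by (auto simp: cm_mult divdiff_def simp del: One_nat_def)
qed (simp add: cm_mult)

lemma icm_sum: "finite A \<Longrightarrow> (\<And>i. i \<in> A \<Longrightarrow> icm r (f i)) \<Longrightarrow> icm r (\<lambda>m. \<Sum>i\<in>A. f i m)"
  by (induction A rule: finite_induct) (auto simp: icm_const icm_add)

text \<open>The negated divided difference of \<open>1 / (s + c)\<close> at 0 is
  \<open>1 / c\<close> times the function itself, so all levels follow at once. The bound
  \<open>1 < c\<close> keeps the denominator positive at index 0, that is at
  \<open>s = -1\<close>.\<close>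

lemma icm_inverse:
  assumes "1 < c"
  shows "icm r (\<lambda>m. 1 / (real m - 1 + c))"
proof (induction r)
  case 0
  then show ?case using cm_inverse[of "c - 1"] assms by (simp add: algebra_simps)
next
  case (Suc r)
  have "icm r (\<lambda>m. 1 / c * (1 / (real m - 1 + c)))"
    using assms by (intro icm_mult Suc icm_const) simp
  moreover have "divdiff (\<lambda>m. 1 / (real m - 1 + c)) (\<lambda>m. 1 / c * (1 / (real m - 1 + c)))"
    unfolding divdiff_def
  proof
    fix m
    have "real m - 1 + c \<noteq> 0" using assms by linarith
    then show "(real m - 1) * (1 / c * (1 / (real m - 1 + c))) = 1 / (real 1 - 1 + c) - 1 / (real m - 1 + c)"
      using assms by (simp add: divide_simps)
  qed
  ultimately show ?case using icm_imp_cm[OF Suc] by auto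
qed

text \<open>Away from index 1 the divided differences are determined by \<open>X N\<close> and
  converge. At index 1 they are free, but monotonicity bounds them by their values at index 0, so a
  subsequence converges there too, and its limit completes the divided difference of
  \<open>x\<close>.\<close>

lemma icm_limit:
  assumes "\<And>N. icm r (X N)" and "\<And>m. (\<lambda>N. X N m) \<longlonglongrightarrow> x m"
  shows "icm r x"
  using assms
proof (induction r arbitrary: X x)
  case 0
  then show ?case using cm_limit by auto
next
  case (Suc r)
  have cmx: "cm x" using Suc.prems cm_limit icm_imp_cm by metis
  have "\<exists>z. icm r z \<and> divdiff (X N) z" for N
    using Suc.prems(1)[of N] by simp
  then obtain Z where Z: "\<And>N. icm r (Z N)" "\<And>N. divdiff (X N) (Z N)"
    by metis
  have Zdiv: "Z N m = (X N 1 - X N m) / (real m - 1)" if "m \<noteq> 1" for N m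
    using Z(2)[of N, unfolded divdiff_def, rule_format, of m] that by (simp add: divide_simps mult.commute)
  have lim: "(\<lambda>N. Z N m) \<longlonglongrightarrow> (x 1 - x m) / (real m - 1)" if "m \<noteq> 1" for m
    using that unfolding Zdiv[OF that] by (intro tendsto_intros Suc.prems) auto
  have "convergent (\<lambda>N. Z N 0)" using lim[of 0] by (auto simp: convergent_def)
  then have "Bseq (\<lambda>N. Z N 0)" by (rule convergent_imp_Bseq)
  moreover have "norm (Z N 1) \<le> norm (Z N 0)" for N
    using cm_decreasing[OF icm_imp_cm[OF Z(1)], of N 0] cm_nonneg[OF icm_imp_cm[OF Z(1)], of N 0]
     cm_nonneg[OF icm_imp_cm[OF Z(1)], of N 1] by simp
  ultimately have "Bseq (\<lambda>N. Z N 1)"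
    unfolding Bseq_def by (meson order_trans)
  then have "bounded (range (\<lambda>N. Z N 1))" by (simp add: Bseq_eq_bounded)
  then obtain l \<sigma> where s: "strict_mono \<sigma>" and l: "((\<lambda>N. Z N 1) \<circ> \<sigma>) \<longlonglongrightarrow> l"
    using bounded_imp_convergent_subsequence by blast
  define z where "z m = (if m = 1 then l else (x 1 - x m) / (real m - 1))" for m
  have zlim: "(\<lambda>N. Z (\<sigma> N) m) \<longlonglongrightarrow> z m" for m
    using l LIMSEQ_subseq_LIMSEQ[OF lim s, of m] by (cases "m = 1") (auto simp: z_def o_def)
  have "icm r z" by (rule Suc.IH[OF Z(1) zlim])
  moreover have "divdiff x z"
    by (auto simp: z_def divdiff_def divide_simps)
  ultimately show ?case unfolding icm.simps using cmx by blast
qed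

section \<open>The reciprocal of the harmonic numbers\<close>

text \<open>Lagrange interpolation in degree equal to the number of nodes: since \<open>p\<close> is
  monic, the nodal polynomial supplies the top coefficient, and both sides agree at every
  node.\<close>

lemma lagrange_monic:
  fixes p :: "real poly" and w :: "'i \<Rightarrow> real"
  assumes I: "finite I" "inj_on w I" and p: "degree p = card I" "lead_coeff p = 1"
  shows "poly p x = (\<Prod>i\<in>I. x - w i) +
    (\<Sum>i\<in>I. poly p (w i) / (\<Prod>l\<in>I - {i}. w i - w l) * (\<Prod>l\<in>I - {i}. x - w l))"
proof (cases "I = {}")
  case True
  then show ?thesis using p by (auto elim!: degree_eq_zeroE)
next
  case False
  define c where "c i = poly p (w i) / (\<Prod>l\<in>I - {i}. w i - w l)" for i
  define q where "q = (\<Sum>i\<in>I. smult (c i) (\<Prod>l\<in>I - {i}. [:- w l, 1:]))"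
  define V where "V = (\<Prod>i\<in>I. [:- w i, 1:])"
  have n: "0 < card I" using False I by (simp add: card_gt_0_iff)
  have dV: "degree V = card I"
    unfolding V_def by (subst degree_prod_sum_eq) simp_all
  have lV: "lead_coeff V = 1"
    unfolding V_def by (subst lead_coeff_prod) simp
  have "degree q < card I"
    unfolding q_def
  proof (rule degree_sum_less)
    fix i assume i: "i \<in> I"
    have "degree (\<Prod>l\<in>I - {i}. [:- w l, 1:]) = card I - 1"
      using i I by (subst degree_prod_sum_eq) simp_all
    then show "degree (smult (c i) (\<Prod>l\<in>I - {i}. [:- w l, 1:])) < card I"
      using degree_smult_le[of "c i"] n by (metis diff_less le_less_trans zero_less_one)
  qed (rule n)
  have q: "poly q (w j) = poly p (w j)" if j: "j \<in> I" for j
  proof -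
    have "poly q (w j) = (\<Sum>i\<in>I. c i * (\<Prod>l\<in>I - {i}. w j - w l))"
      by (simp add: q_def poly_sum poly_prod)
    also have "\<dots> = (\<Sum>i\<in>{j}. c i * (\<Prod>l\<in>I - {i}. w j - w l))"
      using j I by (intro sum.mono_neutral_right) auto
    also have "\<dots> = poly p (w j)"
      using I j by (auto simp: c_def prod_zero_iff inj_on_def)
    finally show ?thesis .
  qed
  have "p = V + q"
  proof (rule poly_eqI_degree_lead_coeff[where n = "card I" and A = "w ` I"])
    show "coeff p (card I) = coeff (V + q) (card I)"
      using p lV dV \<open>degree q < card I\<close> by (simp add: coeff_eq_0)
    show "degree (V + q) \<le> card I"
      using dV \<open>degree q < card I\<close> by (intro degree_add_le) auto
    fix z assume "z \<in> w ` I"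
    then show "poly p z = poly (V + q) z"
      using I by (auto simp: V_def poly_prod q)
  qed (use p I in \<open>simp_all add: card_image\<close>)
  then have "poly p x = poly V x + poly q x" by simp
  then show ?thesis by (simp add: V_def q_def c_def poly_sum poly_prod)
qed

lemma poly_eq_coeff_mult_prod:
  fixes p :: "real poly" and w :: "'i \<Rightarrow> real"
  assumes I: "finite I" "inj_on w I" and p: "degree p \<le> card I"
    and root: "\<And>i. i \<in> I \<Longrightarrow> poly p (w i) = 0"
  shows "poly p x = coeff p (card I) * (\<Prod>i\<in>I. x - w i)"
proof -
  define V where "V = (\<Prod>i\<in>I. [:- w i, 1:])"
  have dV: "degree V = card I"
    unfolding V_def by (subst degree_prod_sum_eq) simp_all
  have lV: "lead_coeff V = 1"
    unfolding V_def by (subst lead_coeff_prod) simp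
  have "p = smult (coeff p (card I)) V"
  proof (rule poly_eqI_degree_lead_coeff[where n = "card I" and A = "w ` I"])
    show "coeff p (card I) = coeff (smult (coeff p (card I)) V) (card I)"
      using lV dV by simp
    show "degree (smult (coeff p (card I)) V) \<le> card I"
      using dV degree_smult_le[of "coeff p (card I)" V] by simp
    fix z assume "z \<in> w ` I"
    then show "poly p z = poly (smult (coeff p (card I)) V) z"
      using I root by (auto simp: V_def poly_prod)
  qed (use p I in \<open>simp_all add: card_image\<close>)
  then have "poly p x = coeff p (card I) * poly V x" by (metis poly_smult)
  then show ?thesis by (simp add: V_def poly_prod)
qed

section \<open>Partial fractions of the reciprocal of the truncated series\<close>

text \<open>The numerator of the sum of \<open>1 / (j (x - j))\<close> over the common denominator
  of all \<open>x - j\<close>. With \<open>x = - s\<close>, the truncated series for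
  \<open>h_s\<close> is \<open>- s\<close> times this quotient; the change of sign makes the poles
  \<open>1, ..., N\<close> and the zeros between them positive.\<close>

definition truncated_numerator :: "nat \<Rightarrow> real poly" where
  "truncated_numerator N = (\<Sum>j\<in>{1..N}. smult (1 / real j) (\<Prod>i\<in>{1..N} - {j}. [:- real i, 1:]))"

lemma poly_truncated_numerator:
  "poly (truncated_numerator N) x = (\<Sum>j\<in>{1..N}. 1 / real j * (\<Prod>i\<in>{1..N} - {j}. x - real i))"
  by (simp add: truncated_numerator_def poly_sum poly_prod)

lemma poly_truncated_numerator_divide:
  assumes "\<And>j. j \<in> {1..N} \<Longrightarrow> x \<noteq> real j"
  shows "poly (truncated_numerator N) x / (\<Prod>j\<in>{1..N}. x - real j) = (\<Sum>j\<in>{1..N}. 1 / (real j * (x - real j)))"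
proof -
  have "1 / real j * (\<Prod>i\<in>{1..N} - {j}. x - real i) / (\<Prod>j\<in>{1..N}. x - real j) =
      1 / (real j * (x - real j))"
    if j: "j \<in> {1..N}" for j
  proof -
    have "(\<Prod>i\<in>{1..N}. x - real i) = (x - real j) * (\<Prod>i\<in>{1..N} - {j}. x - real i)"
      using j by (subst prod.remove[of _ j]) auto
    moreover have "(\<Prod>i\<in>{1..N} - {j}. x - real i) \<noteq> 0" using assms by auto
    ultimately show ?thesis by simp
  qed
  then show ?thesis
    unfolding poly_truncated_numerator sum_divide_distrib
    by (intro sum.cong refl)
qed

lemma degree_truncated_numerator: "degree (truncated_numerator N) \<le> N - 1"
  unfolding truncated_numerator_def
proof (rule degree_sum_le)
  fix j assume j: "j \<in> {1..N}"
  have "degree (\<Prod>i\<in>{1..N} - {j}. [:- real i, 1:]) = N - 1"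
    using j by (subst degree_prod_sum_eq) simp_all
  then show "degree (smult (1 / real j) (\<Prod>i\<in>{1..N} - {j}. [:- real i, 1:])) \<le> N - 1"
    using degree_smult_le by metis
qed simp

lemma coeff_truncated_numerator: "coeff (truncated_numerator N) (N - 1) = harm N"
proof -
  have "coeff (\<Prod>i\<in>{1..N} - {j}. [:- real i, 1:]) (N - 1) = 1" if j: "j \<in> {1..N}" for j
  proof -
    have "degree (\<Prod>i\<in>{1..N} - {j}. [:- real i, 1:]) = N - 1"
      using j by (subst degree_prod_sum_eq) simp_all
    moreover have "lead_coeff (\<Prod>i\<in>{1..N} - {j}. [:- real i, 1:]) = 1"
      by (subst lead_coeff_prod) simp
    ultimately show ?thesis by simp
  qed
  then show ?thesis by (simp add: truncated_numerator_def coeff_sum harm_def inverse_eq_divide)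
qed

text \<open>At a pole only one summand of the numerator survives. In the product of the values at
  \<open>j\<close> and \<open>j + 1\<close>, each factor pair \<open>(j - i) (j + 1 - i)\<close> is
  positive because no integer lies strictly between \<open>j\<close> and \<open>j + 1\<close>; the
  remaining factors \<open>-1\<close> and \<open>1\<close> give a sign change.\<close>

lemma truncated_numerator_root:
  assumes "1 \<le> j" "j < N"
  shows "\<exists>x. real j < x \<and> x < real j + 1 \<and> poly (truncated_numerator N) x = 0"
proof -
  have val: "poly (truncated_numerator N) (real m) = 1 / real m * (\<Prod>i\<in>{1..N} - {m}. real m - real i)"
    if m: "m \<in> {1..N}" for m
  proof -
    have "poly (truncated_numerator N) (real m) = (\<Sum>j\<in>{m}. 1 / real j * (\<Prod>i\<in>{1..N} - {j}. real m - real i))"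
      unfolding poly_truncated_numerator using m by (intro sum.mono_neutral_right) auto
    then show ?thesis by simp
  qed
  define S where "S = {1..N} - {j, Suc j}"
  have "{1..N} - {j} = insert (Suc j) S" "{1..N} - {Suc j} = insert j S" "finite S" "j \<notin> S" "Suc j \<notin> S"
    using assms by (auto simp: S_def)
  then have e: "(\<Prod>i\<in>{1..N} - {j}. real j - real i) = - (\<Prod>i\<in>S. real j - real i)"
    "(\<Prod>i\<in>{1..N} - {Suc j}. real (Suc j) - real i) = (\<Prod>i\<in>S. real (Suc j) - real i)"
    by simp_all
  have "0 < (\<Prod>i\<in>S. (real j - real i) * (real (Suc j) - real i))"
    by (rule prod_pos) (auto simp: S_def zero_less_mult_iff)
  then have "poly (truncated_numerator N) (real j) * poly (truncated_numerator N) (real (Suc j)) < 0"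
    using assms by (subst (1 2) val) (simp_all only: e prod.distrib, auto simp: field_simps intro!: divide_pos_pos add_pos_pos)
  from poly_IVT[OF _ this] show ?thesis by auto
qed

text \<open>The residue at \<open>s = 0\<close> of the reciprocal of the truncated series, whose
  derivative there is the sum of \<open>1 / j ^ 2\<close>.\<close>

definition recip_square_sum :: "nat \<Rightarrow> real" where
  "recip_square_sum N = 1 / (\<Sum>j\<in>{1..N}. 1 / real j ^ 2)"

text \<open>The roots of the numerator of \<open>\<Sum>j\<le>N. s / (j (j + s))\<close> interlace with its poles,
  which makes all residues of the reciprocal positive.\<close>
lemma truncated_reciprocal:
  assumes N: "1 \<le> N"
  obtains C c \<rho> where "0 \<le> C" "\<And>i. i \<in> {1..<N} \<Longrightarrow> 0 \<le> c i"
    "\<And>i. i \<in> {1..<N} \<Longrightarrow> (1::real) < \<rho> i"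
    "\<And>s. 1 \<le> s \<Longrightarrow> 1 / (\<Sum>j\<in>{1..N}. s / (real j * (real j + s))) =
       recip_square_sum N / s + (C + (\<Sum>i\<in>{1..<N}. c i / (s + \<rho> i)))"
    "C + (\<Sum>i\<in>{1..<N}. c i / (- 1 + \<rho> i)) = recip_square_sum N"
proof -
  define H :: real where "H = harm N"
  have H: "0 < H" using N by (simp add: H_def harm_pos)
  obtain r where r: "\<And>j. j \<in> {1..<N} \<Longrightarrow> real j < r j \<and> r j < real j + 1 \<and> poly (truncated_numerator N) (r j) = 0"
    using truncated_numerator_root[of _ N] by (metis atLeastLessThan_iff)
  \<comment> \<open>The zero of the series at \<open>s = 0\<close> is adjoined as
    \<open>\<rho> 0\<close>. Then \<open>\<rho> i\<close> lies between \<open>i\<close> and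
    \<open>i + 1\<close> for all \<open>i < N\<close>, and there are as many zeros as poles.\<close>
  define \<rho> where "\<rho> j = (if j = 0 then 0 else r j)" for j
  have \<rho>0: "\<rho> 0 = 0" by (simp add: \<rho>_def)
  have \<rho>: "real j < \<rho> j" "\<rho> j < real j + 1" "poly (truncated_numerator N) (\<rho> j) = 0" if "j \<in> {1..<N}" for j
    using r[OF that] that by (auto simp: \<rho>_def)
  have \<rho>b: "real j \<le> \<rho> j" "\<rho> j < real j + 1" if "j < N" for j
    using \<rho>[of j] \<rho>0 that by (cases "j = 0"; force)+
  have \<rho>_less: "\<rho> i < \<rho> j" if "i < j" "j < N" for i j
  proof -
    have "real i + 1 \<le> real j" using that by simp
    then show ?thesis using \<rho>b[of i] \<rho>b[of j] that by linarith
  qed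
  have inj: "inj_on \<rho> {..<N}"
    using \<rho>_less by (auto simp: inj_on_def) (metis less_irrefl nat_neq_iff)
  have N0: "{..<N} = insert 0 {1..<N}" "{..<N} - {0} = {1..<N}" using N by auto

  have Q: "poly (truncated_numerator N) x = H * (\<Prod>i\<in>{1..<N}. x - \<rho> i)" for x
  proof -
    have "poly (truncated_numerator N) x = coeff (truncated_numerator N) (card {1..<N}) * (\<Prod>i\<in>{1..<N}. x - \<rho> i)"
      using inj \<rho> degree_truncated_numerator by (intro poly_eq_coeff_mult_prod) (auto simp: inj_on_def)
    then show ?thesis by (simp add: coeff_truncated_numerator[simplified] H_def)
  qed

  define P where "P x = (\<Prod>j\<in>{1..N}. x - real j)" for x
  define D where "D i = (\<Prod>l\<in>{..<N} - {i}. \<rho> i - \<rho> l)" for i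
  \<comment> \<open>\<open>b i\<close> is the negated residue at \<open>\<rho> i\<close> of
    \<open>P x\<close> divided by the product of all \<open>x - \<rho> l\<close>.\<close>
  define b where "b i = - P (\<rho> i) / D i" for i
  have lag: "P x = (\<Prod>i\<in>{..<N}. x - \<rho> i) - (\<Sum>i\<in>{..<N}. b i * (\<Prod>l\<in>{..<N} - {i}. x - \<rho> l))" for x
  proof -
    have "degree (\<Prod>j\<in>{1..N}. [:- real j, 1:]) = card {..<N}"
      by (subst degree_prod_sum_eq) simp_all
    moreover have "lead_coeff (\<Prod>j\<in>{1..N}. [:- real j, 1:]) = 1"
      by (subst lead_coeff_prod) simp
    ultimately have "poly (\<Prod>j\<in>{1..N}. [:- real j, 1:]) x =
        (\<Prod>i\<in>{..<N}. x - \<rho> i) + (\<Sum>i\<in>{..<N}. poly (\<Prod>j\<in>{1..N}. [:- real j, 1:]) (\<rho> i) /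
          (\<Prod>l\<in>{..<N} - {i}. \<rho> i - \<rho> l) * (\<Prod>l\<in>{..<N} - {i}. x - \<rho> l))"
      using inj by (intro lagrange_monic) simp_all
    then show ?thesis
      by (simp add: poly_prod P_def b_def D_def sum_negf)
  qed
  have b_pos: "0 < b i" if i: "i < N" for i
  proof -
    \<comment> \<open>The zero \<open>l + 1\<close> of \<open>P\<close> is paired with
      \<open>\<rho> l\<close>. Seen from \<open>\<rho> i\<close>, both lie to the left for
      \<open>l < i\<close> and both to the right for \<open>l > i\<close>, so each quotient is
      positive; the unpaired factor leaves \<open>i + 1 - \<rho> i > 0\<close>.\<close>
    have "P (\<rho> i) = (\<Prod>l\<in>{..<N}. \<rho> i - real (Suc l))"
      unfolding P_def by (rule prod.reindex_bij_witness[of _ Suc "\<lambda>j. j - 1"]) auto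
    also have "\<dots> = (\<rho> i - real (Suc i)) * (\<Prod>l\<in>{..<N} - {i}. \<rho> i - real (Suc l))"
      using i by (subst prod.remove[of _ i]) auto
    finally have Pi: "P (\<rho> i) = (\<rho> i - real (Suc i)) * (\<Prod>l\<in>{..<N} - {i}. \<rho> i - real (Suc l))" .
    have "b i = (real (Suc i) - \<rho> i) * (\<Prod>l\<in>{..<N} - {i}. (\<rho> i - real (Suc l)) / (\<rho> i - \<rho> l))"
      by (simp only: b_def D_def Pi prod_dividef minus_mult_left minus_diff_eq times_divide_eq_right)
    moreover have "0 < (\<Prod>l\<in>{..<N} - {i}. (\<rho> i - real (Suc l)) / (\<rho> i - \<rho> l))"
    proof (rule prod_pos)
      fix l assume l: "l \<in> {..<N} - {i}"
      show "0 < (\<rho> i - real (Suc l)) / (\<rho> i - \<rho> l)"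
      proof (cases "l < i")
        case True
        have "real (Suc l) \<le> real i" using True by simp
        then show ?thesis using \<rho>[of i] \<rho>_less[OF True i] True i
          by (intro divide_pos_pos) auto
      next
        case False
        then have "i < l" using l by auto
        moreover then have "real i + 1 \<le> real l" by simp
        ultimately show ?thesis using \<rho>b[OF i] \<rho>_less[of i l] l
          by (intro divide_neg_neg) auto
      qed
    qed
    ultimately show ?thesis using \<rho>b[OF i] by simp
  qed
  have frac: "P x / (\<Prod>i\<in>{..<N}. x - \<rho> i) = 1 - (\<Sum>i\<in>{..<N}. b i / (x - \<rho> i))"
    if x: "\<And>i. i < N \<Longrightarrow> x \<noteq> \<rho> i" for x
  proof -
    have nz: "(\<Prod>i\<in>{..<N}. x - \<rho> i) \<noteq> 0" using x by auto
    have "b i * (\<Prod>l\<in>{..<N} - {i}. x - \<rho> l) / (\<Prod>i\<in>{..<N}. x - \<rho> i) = b i / (x - \<rho> i)" if "i < N" for i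
      using that nz x by (subst (2) prod.remove[of _ i]) auto
    then have "(\<Sum>i\<in>{..<N}. b i * (\<Prod>l\<in>{..<N} - {i}. x - \<rho> l)) / (\<Prod>i\<in>{..<N}. x - \<rho> i) =
       (\<Sum>i\<in>{..<N}. b i / (x - \<rho> i))"
      unfolding sum_divide_distrib
      by (intro sum.cong refl) simp
    then show ?thesis unfolding lag using nz by (simp add: diff_divide_distrib)
  qed
  \<comment> \<open>The residue at 0 is read off by evaluating the numerator at \<open>x = 0\<close>
    in two ways: through its zeros, and as a sum over the poles.\<close>
  have b0: "b 0 = H * recip_square_sum N"
  proof -
    have nz: "P 0 \<noteq> 0" by (auto simp: P_def)
    have "H * D 0 / P 0 = poly (truncated_numerator N) 0 / (\<Prod>j\<in>{1..N}. 0 - real j)"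
      by (simp add: D_def N0 Q \<rho>0 P_def)
    also have "\<dots> = (\<Sum>j\<in>{1..N}. 1 / (real j * (0 - real j)))"
      by (rule poly_truncated_numerator_divide) auto
    also have "\<dots> = - (\<Sum>j\<in>{1..N}. 1 / real j ^ 2)"
      by (simp add: power2_eq_square sum_negf)
    finally have *: "H * D 0 / P 0 = - (\<Sum>j\<in>{1..N}. 1 / real j ^ 2)" .
    then have "(\<Sum>j\<in>{1..N}. 1 / real j ^ 2) = H * (D 0 / - P 0)" by simp
    moreover have "\<rho> l \<noteq> 0" if "l \<in> {1..<N}" for l using \<rho>(1)[OF that] by linarith
    then have "D 0 \<noteq> 0" by (simp add: D_def N0 \<rho>0)
    ultimately show ?thesis using nz H by (simp add: recip_square_sum_def b_def \<rho>0)
  qed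

  show ?thesis
  \<comment> \<open>The constant \<open>1 / H\<close> is the value of the reciprocal at
    \<open>s\<close> equal to infinity, where the truncated series tends to
    \<open>harm N\<close>.\<close>
  proof (rule that[of "1 / H" "\<lambda>i. b i / H" \<rho>])
    show "0 \<le> 1 / H" using H by simp
    show "0 \<le> b i / H" if "i \<in> {1..<N}" for i using b_pos[of i] that H by simp
    show "1 < \<rho> i" if "i \<in> {1..<N}" for i
    proof -
      have "1 \<le> real i" using that by simp
      then show ?thesis using \<rho>(1)[OF that] by linarith
    qed
    have split: "(\<Sum>i\<in>{..<N}. b i / (s + \<rho> i)) = b 0 / s + (\<Sum>i\<in>{1..<N}. b i / (s + \<rho> i))" for s
      unfolding N0(1) by (simp add: \<rho>0)
    have neg: "(\<Sum>i\<in>{..<N}. b i / (- s - \<rho> i)) = - (\<Sum>i\<in>{..<N}. b i / (s + \<rho> i))" for s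
    proof -
      have "b i / (- s - \<rho> i) = - (b i / (s + \<rho> i))" for i
        by (metis minus_add_distrib minus_divide_right diff_conv_add_uminus)
      then show ?thesis by (simp only: sum_negf)
    qed
    show "1 / (\<Sum>j\<in>{1..N}. s / (real j * (real j + s))) =
       recip_square_sum N / s + (1 / H + (\<Sum>i\<in>{1..<N}. b i / H / (s + \<rho> i)))" if s: "1 \<le> s" for s
    proof -
      have "(\<Sum>j\<in>{1..N}. s / (real j * (real j + s))) = - s * (\<Sum>j\<in>{1..N}. 1 / (real j * (- s - real j)))"
      proof -
        have "s / (real j * (real j + s)) = - s * (1 / (real j * (- s - real j)))" for j
        proof -
          have "- s - real j = - (real j + s)" by simp
          then show ?thesis by (simp only: mult_minus_right minus_divide_right[symmetric]) simp
        qed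
        then show ?thesis unfolding sum_distrib_left by (simp only:)
      qed
      also have "\<dots> = - s * (poly (truncated_numerator N) (- s) / P (- s))"
        unfolding P_def using s by (subst poly_truncated_numerator_divide) auto
      also have "\<dots> = H * (\<Prod>i\<in>{..<N}. - s - \<rho> i) / P (- s)"
        unfolding Q N0(1) by (simp add: \<rho>0)
      finally have "1 / (\<Sum>j\<in>{1..N}. s / (real j * (real j + s))) =
          1 / H * (P (- s) / (\<Prod>i\<in>{..<N}. - s - \<rho> i))" by simp
      also have "P (- s) / (\<Prod>i\<in>{..<N}. - s - \<rho> i) = 1 - (\<Sum>i\<in>{..<N}. b i / (- s - \<rho> i))"
      proof (rule frac)
        show "- s \<noteq> \<rho> i" if "i < N" for i using \<rho>b(1)[OF that] s of_nat_0_le_iff[of i, where 'a = real] by linarith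
      qed
      also have "\<dots> = b 0 / s + (1 + (\<Sum>i\<in>{1..<N}. b i / (s + \<rho> i)))"
        unfolding neg split by simp
      finally show ?thesis
        using H by (simp add: b0 distrib_left sum_distrib_left mult.commute)
    qed
    \<comment> \<open>Since \<open>s = -1\<close> is a pole of the truncated series, its reciprocal
      vanishes there. This fixes the value of the remainder at \<open>s = -1\<close>, which is index
      0.\<close>
    have "P 1 = 0" using N by (auto simp: P_def)
    moreover have "1 \<noteq> \<rho> i" if "i < N" for i
      using \<rho>(1)[of i] \<rho>0 that by (cases "i = 0") auto
    ultimately have "0 = 1 - (\<Sum>i\<in>{..<N}. b i / (1 - \<rho> i))" using frac[of 1] by simp
    then have "0 = 1 + (\<Sum>i\<in>{..<N}. b i / (- 1 + \<rho> i))" using neg[of "- 1"] by simp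
    then have "b 0 = 1 + (\<Sum>i\<in>{1..<N}. b i / (- 1 + \<rho> i))" unfolding split by simp
    then have "b 0 / H = (1 + (\<Sum>i\<in>{1..<N}. b i / (- 1 + \<rho> i))) / H" by simp
    then show "1 / H + (\<Sum>i\<in>{1..<N}. b i / H / (- 1 + \<rho> i)) = recip_square_sum N"
      using H by (simp add: b0 add_divide_distrib sum_divide_distrib mult.commute)
  qed
qed

section \<open>Passage to the limit in the truncation\<close>

lemma recip_square_sum_lim: "recip_square_sum \<longlonglongrightarrow> 6 / pi\<^sup>2"
proof -
  have "(\<lambda>n. \<Sum>j<n. 1 / (real j + 1)\<^sup>2) \<longlonglongrightarrow> pi\<^sup>2 / 6"
    using inverse_squares_sums by (simp add: sums_def add.commute)
  moreover have "(\<Sum>j<n. 1 / (real j + 1)\<^sup>2) = (\<Sum>j\<in>{1..n}. 1 / real j ^ 2)" for n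
    by (rule sum.reindex_bij_witness[of _ "\<lambda>j. j - 1" Suc]) (auto simp: add.commute)
  ultimately have "(\<lambda>n. 1 / (\<Sum>j\<in>{1..n}. 1 / real j ^ 2)) \<longlonglongrightarrow> 1 / (pi\<^sup>2 / 6)"
    by (intro tendsto_intros) auto
  then show ?thesis by (simp add: recip_square_sum_def[abs_def])
qed

text \<open>Each summand is \<open>1 / j - 1 / (j + s)\<close>. Hence passing from \<open>s\<close>
  to \<open>s + 1\<close> changes the truncated sum by \<open>1 / (s + 1) - 1 / (s + N + 1)\<close>,
  and induction on \<open>s\<close> applies.\<close>

lemma harm_truncation_lim:
  "(\<lambda>N. \<Sum>j\<in>{1..N}. real s / (real j * (real j + real s))) \<longlonglongrightarrow> harm s"
proof (induction s)
  case 0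
  then show ?case by (simp add: harm_def)
next
  case (Suc s)
  have pf: "real k / (real (Suc n) * (real (Suc n) + real k)) = 1 / real (Suc n) - 1 / real (Suc (n + k))"
    for k n
  proof -
    have "real (Suc n) + real k = real (Suc (n + k))" "real k = real (Suc (n + k)) - real (Suc n)"
      by simp_all
    then show ?thesis by (simp only: diff_divide_distrib) (simp del: of_nat_Suc)
  qed
  have tele: "(\<Sum>j\<in>{1..N}. real (Suc s) / (real j * (real j + real (Suc s)))) =
    (\<Sum>j\<in>{1..N}. real s / (real j * (real j + real s))) + (1 / real (Suc s) - 1 / real (Suc (s + N)))" for N
  proof (induction N)
    case (Suc N)
    have "{1..Suc N} = insert (Suc N) {1..N}" by auto
    then show ?case
      using Suc pf[of s N] pf[of "Suc s" N] by (simp del: of_nat_Suc add: add.commute)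
  qed simp
  have "(\<lambda>N. 1 / real (Suc (s + N))) \<longlonglongrightarrow> 0"
    using LIMSEQ_ignore_initial_segment[OF lim_1_over_n, of "Suc s"] by (simp add: add_ac)
  then have "(\<lambda>N. (\<Sum>j\<in>{1..N}. real s / (real j * (real j + real s))) +
     (1 / real (Suc s) - 1 / real (Suc (s + N)))) \<longlonglongrightarrow> harm s + (1 / real (Suc s) - 0)"
    by (intro tendsto_intros Suc)
  then show ?case unfolding tele by (simp add: harm_Suc inverse_eq_divide)
qed

text \<open>The truncated remainders converge at index 0, where they equal
  \<open>recip_square_sum\<close>, and at every index above 1 through the series. Index 1 is
  \<open>s = 0\<close>, where the decomposition gives no value; the values there are bounded by
  those at index 0, and a convergent subsequence provides one.\<close>

lemma reciprocal_harm_icm: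
  obtains R where "icm r R" "\<And>s. 1 \<le> s \<Longrightarrow> 1 / harm s = 6 / pi\<^sup>2 / real s + R (Suc s)"
proof -
  have ex: "\<exists>R. icm r R \<and> R 0 = recip_square_sum N \<and> (\<forall>s\<ge>1. R (Suc s) =
     1 / (\<Sum>j\<in>{1..N}. real s / (real j * (real j + real s))) - recip_square_sum N / real s)" if N: "1 \<le> N" for N
  proof (rule truncated_reciprocal[OF N])
    fix C c \<rho>
    assume *: "0 \<le> C" "\<And>i. i \<in> {1..<N} \<Longrightarrow> 0 \<le> c i" "\<And>i. i \<in> {1..<N} \<Longrightarrow> (1::real) < \<rho> i"
      "\<And>s. 1 \<le> s \<Longrightarrow> 1 / (\<Sum>j\<in>{1..N}. s / (real j * (real j + s))) =
       recip_square_sum N / s + (C + (\<Sum>i\<in>{1..<N}. c i / (s + \<rho> i)))"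
      "C + (\<Sum>i\<in>{1..<N}. c i / (- 1 + \<rho> i)) = recip_square_sum N"
    define R where "R m = C + (\<Sum>i\<in>{1..<N}. c i * (1 / (real m - 1 + \<rho> i)))" for m
    have "icm r R" unfolding R_def[abs_def]
      using * by (intro icm_add icm_const icm_sum icm_mult icm_inverse) auto
    moreover have "R 0 = recip_square_sum N" using *(5) by (simp add: R_def)
    moreover have "R (Suc s) = 1 / (\<Sum>j\<in>{1..N}. real s / (real j * (real j + real s))) - recip_square_sum N / real s"
      if "s \<ge> 1" for s using *(4)[of "real s"] that by (simp add: R_def)
    ultimately show ?thesis by (intro exI[of _ R]) simp
  qed
  have "\<forall>N. \<exists>R. icm r R \<and> R 0 = recip_square_sum (Suc N) \<and> (\<forall>s\<ge>1. R (Suc s) =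
     1 / (\<Sum>j\<in>{1..Suc N}. real s / (real j * (real j + real s))) - recip_square_sum (Suc N) / real s)"
    using ex[of "Suc _"] by simp
  from choice[OF this] obtain Y where *: "\<forall>N. icm r (Y N) \<and> Y N 0 = recip_square_sum (Suc N) \<and> (\<forall>s\<ge>1. Y N (Suc s) =
     1 / (\<Sum>j\<in>{1..Suc N}. real s / (real j * (real j + real s))) - recip_square_sum (Suc N) / real s)" ..
  from * have Y: "\<And>N. icm r (Y N)" by blast
  from * have Y0': "\<And>N. Y N 0 = recip_square_sum (Suc N)" by blast
  from * have Ys': "\<And>N s. s \<ge> 1 \<Longrightarrow> Y N (Suc s) =
       1 / (\<Sum>j\<in>{1..Suc N}. real s / (real j * (real j + real s))) - recip_square_sum (Suc N) / real s"
    by blast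
  have Y0: "(\<lambda>N. Y N 0) \<longlonglongrightarrow> 6 / pi\<^sup>2"
    using LIMSEQ_Suc[OF recip_square_sum_lim] by (simp add: Y0')
  have Ys: "(\<lambda>N. Y N (Suc s)) \<longlonglongrightarrow> 1 / harm s - 6 / pi\<^sup>2 / real s" if s: "1 \<le> s" for s
  proof -
    have hs: "harm s \<noteq> (0::real)" using harm_pos_nat[OF s, THEN less_imp_neq] by metis
    have "(\<lambda>N. 1 / (\<Sum>j\<in>{1..Suc N}. real s / (real j * (real j + real s))) - recip_square_sum (Suc N) / real s)
       \<longlonglongrightarrow> 1 / harm s - 6 / pi\<^sup>2 / real s"
      using s by (intro tendsto_diff tendsto_divide[OF tendsto_const LIMSEQ_Suc[OF harm_truncation_lim] hs]
        tendsto_divide[OF LIMSEQ_Suc[OF recip_square_sum_lim] tendsto_const]) simp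
    then show ?thesis unfolding Ys'[OF s] .
  qed
  have "Bseq (\<lambda>N. Y N 0)" using Y0 by (intro convergent_imp_Bseq) (auto simp: convergent_def)
  moreover have "norm (Y N 1) \<le> norm (Y N 0)" for N
    using cm_decreasing[OF icm_imp_cm[OF Y], of N 0] cm_nonneg[OF icm_imp_cm[OF Y], of N 0]
     cm_nonneg[OF icm_imp_cm[OF Y], of N 1] by simp
  ultimately have "Bseq (\<lambda>N. Y N 1)"
    unfolding Bseq_def by (meson order_trans)
  then have "bounded (range (\<lambda>N. Y N 1))" by (simp add: Bseq_eq_bounded)
  then obtain l \<sigma> where s: "strict_mono \<sigma>" and l: "((\<lambda>N. Y N 1) \<circ> \<sigma>) \<longlonglongrightarrow> l"
    using bounded_imp_convergent_subsequence by blast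
  define R where "R m = (if m = 0 then 6 / pi\<^sup>2 else if m = 1 then l
     else 1 / harm (m - 1) - 6 / pi\<^sup>2 / real (m - 1))" for m
  have "(\<lambda>N. Y (\<sigma> N) m) \<longlonglongrightarrow> R m" for m
  proof -
    consider "m = 0" | "m = 1" | s where "m = Suc s" "1 \<le> s"
      by (metis One_nat_def Suc_leI not0_implies_Suc gr0I)
    then show ?thesis
      using l LIMSEQ_subseq_LIMSEQ[OF Y0 s] LIMSEQ_subseq_LIMSEQ[OF Ys s]
      by cases (auto simp: R_def o_def)
  qed
  then have "icm r R" by (rule icm_limit[OF Y])
  moreover have "1 / harm s = 6 / pi\<^sup>2 / real s + R (Suc s)" if "1 \<le> s" for s
    using that by (simp add: R_def)
  ultimately show ?thesis by (rule that)
qed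

section \<open>Powers of the reciprocal\<close>

text \<open>Two sequences \<open>u\<close> and \<open>v\<close> appear because divided differences
  enter with a minus sign. Quantifying over every \<open>r\<close>, with a decomposition that may
  change with \<open>r\<close>, permits any number of divisions by \<open>s\<close>.\<close>

definition laurent_icm :: "nat \<Rightarrow> (nat \<Rightarrow> real) \<Rightarrow> bool" where
  "laurent_icm k f \<longleftrightarrow> (\<forall>r. \<exists>q u v. degree q \<le> k \<and> icm r u \<and> icm r v \<and>
     (\<forall>s\<ge>1. f s = poly q (1 / real s) + u (Suc s) - v (Suc s)))"

lemma laurent_icmE:
  assumes "laurent_icm k f"
  obtains q u v where "degree q \<le> k" "icm r u" "icm r v"
    "\<And>s. 1 \<le> s \<Longrightarrow> f s = poly q (1 / real s) + u (Suc s) - v (Suc s)"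
  using assms unfolding laurent_icm_def by blast

lemma laurent_icmI:
  assumes "\<And>r. \<exists>q u v. degree q \<le> k \<and> icm r u \<and> icm r v \<and>
     (\<forall>s\<ge>1. f s = poly q (1 / real s) + u (Suc s) - v (Suc s))"
  shows "laurent_icm k f"
  using assms unfolding laurent_icm_def by blast

lemma laurent_icm_mono: "laurent_icm k f \<Longrightarrow> k \<le> l \<Longrightarrow> laurent_icm l f"
  unfolding laurent_icm_def by (meson le_trans)

lemma laurent_icm_cong:
  "laurent_icm k f \<Longrightarrow> (\<And>s. 1 \<le> s \<Longrightarrow> f s = g s) \<Longrightarrow> laurent_icm k g"
  unfolding laurent_icm_def by simp

lemma laurent_icm_add:
  assumes "laurent_icm k f" "laurent_icm k g"
  shows "laurent_icm k (\<lambda>s. f s + g s)"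
proof (rule laurent_icmI)
  fix r
  obtain q u v where f: "degree q \<le> k" "icm r u" "icm r v"
    "\<And>s. 1 \<le> s \<Longrightarrow> f s = poly q (1 / real s) + u (Suc s) - v (Suc s)"
    using laurent_icmE[OF assms(1)] by metis
  obtain q' u' v' where g: "degree q' \<le> k" "icm r u'" "icm r v'"
    "\<And>s. 1 \<le> s \<Longrightarrow> g s = poly q' (1 / real s) + u' (Suc s) - v' (Suc s)"
    using laurent_icmE[OF assms(2)] by metis
  show "\<exists>q u v. degree q \<le> k \<and> icm r u \<and> icm r v \<and>
     (\<forall>s\<ge>1. f s + g s = poly q (1 / real s) + u (Suc s) - v (Suc s))"
    using f g
    by (intro exI[of _ "q + q'"] exI[of _ "\<lambda>m. u m + u' m"] exI[of _ "\<lambda>m. v m + v' m"])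
       (simp add: icm_add degree_add_le)
qed

lemma laurent_icm_cmult:
  assumes "laurent_icm k f" "0 \<le> c"
  shows "laurent_icm k (\<lambda>s. c * f s)"
proof (rule laurent_icmI)
  fix r
  obtain q u v where f: "degree q \<le> k" "icm r u" "icm r v"
    "\<And>s. 1 \<le> s \<Longrightarrow> f s = poly q (1 / real s) + u (Suc s) - v (Suc s)"
    using laurent_icmE[OF assms(1)] by metis
  have "degree (smult c q) \<le> k" using f(1) degree_smult_le[of c q] by linarith
  moreover have "icm r (\<lambda>m. c * u m)" "icm r (\<lambda>m. c * v m)"
    using f assms(2) by (auto intro!: icm_mult icm_const)
  moreover have "c * f s = poly (smult c q) (1 / real s) + c * u (Suc s) - c * v (Suc s)" if "1 \<le> s" for s
    unfolding f(4)[OF that] by (simp add: algebra_simps)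
  ultimately show "\<exists>q u v. degree q \<le> k \<and> icm r u \<and> icm r v \<and>
     (\<forall>s\<ge>1. c * f s = poly q (1 / real s) + u (Suc s) - v (Suc s))"
    by (intro exI[of _ "smult c q"] exI[of _ "\<lambda>m. c * u m"] exI[of _ "\<lambda>m. c * v m"]) simp
qed

text \<open>Writing \<open>u = u 1 - s y\<close> gives \<open>u / s = u 1 / s - y\<close>, and
  likewise for \<open>v\<close>. The constants join the polynomial in \<open>1 / s\<close>, the two
  remainders exchange roles, and one level of \<open>icm\<close> is consumed.\<close>

lemma laurent_icm_divide:
  assumes "laurent_icm k f"
  shows "laurent_icm (Suc k) (\<lambda>s. f s / real s)"
proof (rule laurent_icmI)
  fix r
  obtain q u v where f: "degree q \<le> k" "icm (Suc r) u" "icm (Suc r) v"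
    "\<And>s. 1 \<le> s \<Longrightarrow> f s = poly q (1 / real s) + u (Suc s) - v (Suc s)"
    using laurent_icmE[OF assms] by metis
  obtain y z where y: "icm r y" "divdiff u y" and z: "icm r z" "divdiff v z"
    using f(2,3) by auto
  let ?q = "pCons 0 (q + [:u 1 - v 1:])"
  have "degree ?q \<le> Suc k"
    using f(1) by (intro order.trans[OF degree_pCons_le]) (simp add: degree_add_le)
  moreover have "f s / real s = poly ?q (1 / real s) + z (Suc s) - y (Suc s)" if "1 \<le> s" for s
  proof -
    have "u (Suc s) = u 1 - real s * y (Suc s)" "v (Suc s) = v 1 - real s * z (Suc s)"
      using y(2)[unfolded divdiff_def, rule_format, of "Suc s"]
        z(2)[unfolded divdiff_def, rule_format, of "Suc s"] by simp_all
    then show ?thesis using f(4)[OF that] that by (simp add: field_simps)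
  qed
  ultimately show "\<exists>q u v. degree q \<le> Suc k \<and> icm r u \<and> icm r v \<and>
     (\<forall>s\<ge>1. f s / real s = poly q (1 / real s) + u (Suc s) - v (Suc s))"
    using y(1) z(1) by blast
qed

text \<open>The remainders of \<open>f\<close> times \<open>g\<close> are covered by
  \<open>icm_mult\<close>. For the polynomial part, each \<open>g / s ^ j\<close> with
  \<open>j\<close> at most \<open>k\<close> comes from dividing \<open>g\<close> by \<open>s\<close>
  repeatedly, so the degree does not grow.\<close>

lemma laurent_icm_mult_icm:
  assumes "laurent_icm k f" and R: "\<And>r. \<exists>R. icm r R \<and> (\<forall>s\<ge>1. g s = R (Suc s))"
  shows "laurent_icm k (\<lambda>s. f s * g s)"
proof -
  have g: "laurent_icm 0 g"
  proof (rule laurent_icmI)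
    fix r
    from R[of r] obtain R where "icm r R" "\<forall>s\<ge>1. g s = R (Suc s)" by blast
    then show "\<exists>q u v. degree q \<le> 0 \<and> icm r u \<and> icm r v \<and>
       (\<forall>s\<ge>1. g s = poly q (1 / real s) + u (Suc s) - v (Suc s))"
      by (intro exI[of _ 0] exI[of _ R] exI[of _ "\<lambda>_. 0"]) (simp add: icm_const)
  qed
  have power: "laurent_icm j (\<lambda>s. g s / real s ^ j)" for j
  proof (induction j)
    case (Suc j)
    from laurent_icm_divide[OF this] show ?case by (simp add: mult.commute)
  qed (simp add: g)
  have P: "laurent_icm k (\<lambda>s. poly q (1 / real s) * g s)" if "degree q \<le> k" for q
  proof -
    have neg: "laurent_icm k (\<lambda>s. - h s)" if h: "laurent_icm k h" for h
    proof (rule laurent_icmI)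
      fix r
      obtain q u v where f: "degree q \<le> k" "icm r u" "icm r v"
        "\<And>s. 1 \<le> s \<Longrightarrow> h s = poly q (1 / real s) + u (Suc s) - v (Suc s)"
        using laurent_icmE[OF h] by metis
      then show "\<exists>q u v. degree q \<le> k \<and> icm r u \<and> icm r v \<and>
         (\<forall>s\<ge>1. - h s = poly q (1 / real s) + u (Suc s) - v (Suc s))"
        by (intro exI[of _ "- q"] exI[of _ v] exI[of _ u]) simp
    qed
    have "laurent_icm k (\<lambda>s. c * (g s / real s ^ j))" if "j \<le> k" for c j
    proof (cases "0 \<le> c")
      case True
      then show ?thesis by (intro laurent_icm_cmult laurent_icm_mono[OF power that])
    next
      case False
      then have "laurent_icm k (\<lambda>s. - (- c * (g s / real s ^ j)))"
        by (intro neg laurent_icm_cmult laurent_icm_mono[OF power that]) simp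
      then show ?thesis by simp
    qed
    then have monomial: "laurent_icm k (\<lambda>s. c * g s / real s ^ j)" if "j \<le> k" for c j
      using that by simp
    have zero: "laurent_icm k (\<lambda>_. 0)" using monomial[of 0 0] by simp
    have "laurent_icm k (\<lambda>s. \<Sum>j\<in>A. coeff q j * g s / real s ^ j)" if "finite A" "A \<subseteq> {..k}" for A
      using that by (induction A rule: finite_induct) (auto simp: zero intro!: laurent_icm_add monomial)
    from this[of "{..degree q}"] that show ?thesis
      by (simp add: poly_altdef sum_distrib_right power_divide)
  qed
  show ?thesis
  proof (rule laurent_icmI)
    fix r
    obtain q u v where f: "degree q \<le> k" "icm r u" "icm r v"
      "\<And>s. 1 \<le> s \<Longrightarrow> f s = poly q (1 / real s) + u (Suc s) - v (Suc s)"
      using laurent_icmE[OF assms(1)] by metis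
    from R[of r] obtain R where R': "icm r R" "\<And>s. 1 \<le> s \<Longrightarrow> g s = R (Suc s)" by blast
    obtain q' u' v' where h: "degree q' \<le> k" "icm r u'" "icm r v'"
      "\<And>s. 1 \<le> s \<Longrightarrow> poly q (1 / real s) * g s = poly q' (1 / real s) + u' (Suc s) - v' (Suc s)"
      using laurent_icmE[OF P[OF f(1)]] by metis
    have "icm r (\<lambda>m. u' m + u m * R m)" "icm r (\<lambda>m. v' m + v m * R m)"
      using f h R' by (auto intro!: icm_add icm_mult)
    moreover have "f s * g s = poly q' (1 / real s) + (u' (Suc s) + u (Suc s) * R (Suc s)) -
        (v' (Suc s) + v (Suc s) * R (Suc s))" if "1 \<le> s" for s
      using f(4)[OF that] h(4)[OF that] R'(2)[OF that] by algebra
    ultimately show "\<exists>q u v. degree q \<le> k \<and> icm r u \<and> icm r v \<and>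
       (\<forall>s\<ge>1. f s * g s = poly q (1 / real s) + u (Suc s) - v (Suc s))"
      using h(1)
      by (intro exI[of _ q'] exI[of _ "\<lambda>m. u' m + u m * R m"] exI[of _ "\<lambda>m. v' m + v m * R m"]) simp
  qed
qed

text \<open>Put \<open>y = 1 / h_s\<close>, \<open>x = a / s\<close> and \<open>g = y - x\<close>.
  With \<open>d = y ^ Suc k - x ^ Suc k\<close>, the next difference of powers is
  \<open>x * d + d * g + x ^ Suc k * g\<close>. Only the first summand raises the degree, by one, so
  subtracting the top power always leaves degree \<open>k\<close>.\<close>

lemma laurent_icm_harm_power:
  "laurent_icm k (\<lambda>s. 1 / harm s ^ Suc k - (6 / pi\<^sup>2 / real s) ^ Suc k)"
proof -
  define a :: real where "a = 6 / pi\<^sup>2"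
  define g where "g s = 1 / harm s - a / real s" for s
  have a: "0 \<le> a" by (simp add: a_def)
  have R: "\<exists>R. icm r R \<and> (\<forall>s\<ge>1. g s = R (Suc s))" for r
    by (rule reciprocal_harm_icm[of r]) (auto simp: g_def a_def)
  have zero: "laurent_icm 0 (\<lambda>s. 1)"
    by (intro laurent_icmI exI[of _ 1] exI[of _ "\<lambda>_. 0"]) (simp add: icm_const)
  have power: "laurent_icm j (\<lambda>s. (a / real s) ^ j)" for j
  proof (induction j)
    case (Suc j)
    from laurent_icm_cmult[OF laurent_icm_divide[OF this] a] show ?case by simp
  qed (simp add: zero)
  show ?thesis
    unfolding a_def[symmetric]
  proof (induction k)
    case 0
    have "laurent_icm 0 (\<lambda>s. 1 * g s)" by (rule laurent_icm_mult_icm[OF zero R])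
    then show ?case by (simp add: g_def)
  next
    case (Suc k)
    have 1: "laurent_icm (Suc k) (\<lambda>s. a * ((1 / harm s ^ Suc k - (a / real s) ^ Suc k) / real s))"
      by (intro laurent_icm_cmult laurent_icm_divide Suc a)
    have 2: "laurent_icm (Suc k) (\<lambda>s. (1 / harm s ^ Suc k - (a / real s) ^ Suc k) * g s)"
      by (rule laurent_icm_mono[OF laurent_icm_mult_icm[OF Suc R]]) simp
    have 3: "laurent_icm (Suc k) (\<lambda>s. (a / real s) ^ Suc k * g s)"
      by (rule laurent_icm_mult_icm[OF power R])
    have eq: "a * ((y ^ Suc k - x ^ Suc k) / t) + (y ^ Suc k - x ^ Suc k) * (y - x) + x ^ Suc k * (y - x) =
        y ^ Suc (Suc k) - x ^ Suc (Suc k)" if "x = a / t" for x y t :: real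
    proof -
      have "a * ((y ^ Suc k - x ^ Suc k) / t) = x * (y ^ Suc k - x ^ Suc k)" using that by simp
      then show ?thesis by (simp add: algebra_simps)
    qed
    show ?case
      using laurent_icm_add[OF laurent_icm_add[OF 1 2] 3]
      by (rule laurent_icm_cong) (use eq[OF refl, of "1 / harm _" "real _"] in \<open>simp only: g_def power_one_over\<close>)
  qed
qed

section \<open>Alternating binomial sums\<close>

text \<open>A signed binomial transform that starts at \<open>j = 1\<close>, since the sequences
  \<open>1 / h_j ^ k\<close> and \<open>1 / j ^ r\<close> of interest are singular at
  \<open>j = 0\<close>.\<close>

definition altsum :: "nat \<Rightarrow> (nat \<Rightarrow> real) \<Rightarrow> real" where
  "altsum n f = (\<Sum>j\<in>{1..n}. real (n choose j) * (-1) ^ (j + 1) * f j)"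

lemma altsum_add: "altsum n (\<lambda>s. f s + g s) = altsum n f + altsum n g"
  by (simp only: altsum_def distrib_left sum.distrib)

lemma altsum_diff: "altsum n (\<lambda>s. f s - g s) = altsum n f - altsum n g"
  by (simp only: altsum_def right_diff_distrib sum_subtractf)

lemma altsum_cmult: "altsum n (\<lambda>s. c * f s) = c * altsum n f"
  by (simp add: altsum_def sum_distrib_left mult_ac)

lemma altsum_sum: "altsum n (\<lambda>s. \<Sum>i\<in>A. f i s) = (\<Sum>i\<in>A. altsum n (f i))"
  unfolding altsum_def sum_distrib_left by (rule sum.swap)

lemma altsum_cong: "(\<And>s. 1 \<le> s \<Longrightarrow> f s = g s) \<Longrightarrow> altsum n f = altsum n g"
  unfolding altsum_def by (intro sum.cong) auto

lemma altsum_extend: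
  "m \<le> n \<Longrightarrow> altsum m f = (\<Sum>j\<in>{1..n}. real (m choose j) * (-1) ^ (j + 1) * f j)"
  unfolding altsum_def by (intro sum.mono_neutral_left) (auto simp: binomial_eq_0)

text \<open>The shift places \<open>s = 0\<close> at index 1. Supplying the missing term
  \<open>j = 0\<close>, which is \<open>u 1\<close>, turns the sum into an \<open>n\<close>-th
  difference.\<close>

lemma altsum_bdiff: "altsum n (\<lambda>s. u (Suc s)) = u 1 - (bdiff ^^ n) u 1"
proof -
  have "{..n} = insert 0 {1..n}" by auto
  then have "(bdiff ^^ n) u 1 = u 1 + (\<Sum>j\<in>{1..n}. real (n choose j) * (-1) ^ j * u (Suc j))"
    unfolding funpow_bdiff_sum_binomial by simp
  then show ?thesis by (simp add: altsum_def sum_negf)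
qed

text \<open>Pascal's rule leaves \<open>n choose (j - 1)\<close>, which absorption turns into
  \<open>j / (n + 1)\<close> times \<open>Suc n choose j\<close>.\<close>

lemma altsum_Suc:
  "altsum (Suc n) f = altsum n f + altsum (Suc n) (\<lambda>j. real j * f j) / real (Suc n)"
proof -
  have "altsum (Suc n) f - altsum n f =
     (\<Sum>j\<in>{1..Suc n}. (real (Suc n choose j) - real (n choose j)) * (-1) ^ (j + 1) * f j)"
    unfolding altsum_extend[of n "Suc n", OF le_SucI[OF le_refl]]
    unfolding altsum_def
    by (simp only: sum_subtractf[symmetric] left_diff_distrib)
  also have "\<dots> = (\<Sum>j\<in>{1..Suc n}. real (Suc n choose j) * (-1) ^ (j + 1) * (real j * f j) / real (Suc n))"
  proof (rule sum.cong[OF refl])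
    fix j assume "j \<in> {1..Suc n}"
    then obtain i where j: "j = Suc i" by (cases j) auto
    have "real (Suc n) * real (n choose i) = real (Suc n choose Suc i) * real (Suc i)"
      using Suc_times_binomial_eq[of n i] by (metis of_nat_mult)
    then have "real (n choose i) = real (Suc n choose Suc i) * real (Suc i) / real (Suc n)"
      by (simp add: field_simps del: binomial_Suc_Suc)
    moreover have "real (Suc n choose j) - real (n choose j) = real (n choose i)"
      by (simp add: j)
    ultimately show "(real (Suc n choose j) - real (n choose j)) * (-1) ^ (j + 1) * f j =
      real (Suc n choose j) * (-1) ^ (j + 1) * (real j * f j) / real (Suc n)"
      by (simp add: j del: binomial_Suc_Suc)
  qed
  also have "\<dots> = altsum (Suc n) (\<lambda>j. real j * f j) / real (Suc n)"
    unfolding altsum_def sum_divide_distrib ..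
  finally show ?thesis by linarith
qed

section \<open>Binomial coefficients as eigenvectors of the generator\<close>

text \<open>Rearranged, this says that \<open>n choose j\<close> is an eigenvector with eigenvalue
  \<open>harm j\<close>. Pascal's rule reduces \<open>n + 1\<close> to \<open>n\<close>, and
  absorption reconciles the harmonic numbers.\<close>

lemma sum_choose_divide:
  "(\<Sum>l\<in>{1..n}. real ((n - l) choose j) / real l) = real (n choose j) * (harm n - harm j)"
proof (induction n arbitrary: j)
  case 0
  then show ?case by (cases j) (simp_all add: harm_def)
next
  case (Suc n)
  show ?case
  proof (cases j)
    case 0
    then show ?thesis by (simp add: harm_def inverse_eq_divide)
  next
    case (Suc i)
    \<comment> \<open>As \<open>j\<close> is positive, the summand \<open>l = n + 1\<close>
      vanishes, and Pascal's rule applies to all others.\<close>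
    have "(\<Sum>l\<in>{1..Suc n}. real ((Suc n - l) choose j) / real l) =
        (\<Sum>l\<in>{1..n}. real ((n - l) choose i) / real l + real ((n - l) choose j) / real l)"
      by (simp add: Suc Suc_diff_le add_divide_distrib)
    also have "\<dots> = real (n choose i) * (harm n - harm i) + real (n choose j) * (harm n - harm j)"
      by (simp only: sum.distrib Suc.IH)
    also have "\<dots> = real (Suc n choose j) * (harm (Suc n) - harm j)"
    proof -
      have "real (Suc n) * real (n choose i) = real (Suc n choose Suc i) * real (Suc i)"
        using Suc_times_binomial_eq[of n i] by (metis of_nat_mult)
      then have e: "real (Suc n choose j) / real (Suc n) = real (n choose i) / real (Suc i)"
        by (simp add: Suc field_simps del: binomial_Suc_Suc)
      have hj: "harm j = harm i + 1 / real (Suc i)" by (simp add: Suc harm_Suc inverse_eq_divide)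
      have "real (Suc n choose j) * (harm (Suc n) - harm j) =
         real (Suc n choose j) * (harm n - harm j) + real (Suc n choose j) / real (Suc n)"
        by (simp add: harm_Suc inverse_eq_divide algebra_simps)
      also have "\<dots> = (real (n choose i) + real (n choose j)) * (harm n - harm j) + real (n choose i) / real (Suc i)"
        unfolding e by (simp add: Suc)
      also have "\<dots> = real (n choose i) * (harm n - harm i) + real (n choose j) * (harm n - harm j)"
        unfolding hj by (simp add: algebra_simps)
      finally show ?thesis ..
    qed
    finally show ?thesis .
  qed
qed

text \<open>The index \<open>n\<close> stands for the state \<open>n + 1\<close>, with exit rate
  \<open>harm n\<close>, and \<open>l\<close> for the size of a jump. The eigenvector identity is
  applied term by term.\<close>

lemma altsum_generator:
  "harm n * altsum n f - (\<Sum>l\<in>{1..n}. altsum (n - l) f / real l) = altsum n (\<lambda>j. harm j * f j)"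
proof -
  have "(\<Sum>l\<in>{1..n}. altsum (n - l) f / real l) =
     (\<Sum>l\<in>{1..n}. \<Sum>j\<in>{1..n}. real ((n - l) choose j) / real l * ((-1) ^ (j + 1) * f j))"
    by (simp add: altsum_extend[OF diff_le_self] sum_divide_distrib mult.assoc)
  also have "\<dots> = (\<Sum>j\<in>{1..n}. real (n choose j) * (harm n - harm j) * ((-1) ^ (j + 1) * f j))"
    by (subst sum.swap) (simp only: sum_distrib_right[symmetric] sum_choose_divide)
  also have "\<dots> = harm n * altsum n f - altsum n (\<lambda>j. harm j * f j)"
    by (simp add: altsum_def sum_distrib_left sum_subtractf[symmetric] algebra_simps)
  finally show ?thesis by simp
qed

section \<open>Complete homogeneous sums and Newton's identities\<close>

text \<open>The complete homogeneous symmetric polynomial of degree \<open>r\<close> in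
  \<open>1, 1/2, ..., 1/n\<close>. The recursion separates the monomials that contain the last
  variable.\<close>

fun hsym :: "nat \<Rightarrow> nat \<Rightarrow> real" where
  "hsym 0 n = 1"
| "hsym (Suc r) 0 = 0"
| "hsym (Suc r) (Suc n) = hsym (Suc r) n + hsym r (Suc n) / real (Suc n)"

text \<open>By \<open>altsum_Suc\<close> the alternating sums obey the recursion of
  \<open>hsym\<close>. At \<open>n = 0\<close> and \<open>r = 0\<close> the empty sum is 0 while
  \<open>hsym\<close> is 1, hence the restriction on \<open>n\<close>.\<close>

lemma altsum_inverse_power:
  assumes "1 \<le> n"
  shows "altsum n (\<lambda>j. 1 / real j ^ r) = hsym r n"
proof -
  have "altsum (Suc n) (\<lambda>j. 1 / real j ^ r) = hsym r (Suc n)" for n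
  proof (induction r arbitrary: n)
    case 0
    have "(\<Sum>j\<le>Suc n. (-1) ^ j * real (Suc n choose j)) = 0"
      by (rule choose_alternating_sum) simp
    moreover have "{..Suc n} = insert 0 {1..Suc n}" by auto
    ultimately show ?case by (simp add: altsum_def sum_negf mult.commute del: binomial_Suc_Suc)
  next
    case (Suc r)
    have s: "altsum (Suc n) (\<lambda>j. 1 / real j ^ Suc r) =
       altsum n (\<lambda>j. 1 / real j ^ Suc r) + altsum (Suc n) (\<lambda>j. 1 / real j ^ r) / real (Suc n)" for n
      by (subst altsum_Suc) (simp cong: altsum_cong)
    show ?case
    proof (induction n)
      case 0
      show ?case unfolding s using Suc[of 0] by (simp add: altsum_def)
    next
      case (Suc m)
      then show ?case using s[of "Suc m"] Suc.IH \<open>\<And>n. altsum (Suc n) (\<lambda>j. 1 / real j ^ r) = hsym r (Suc n)\<close>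
        by (simp only: hsym.simps)
    qed
  qed
  from this[of "n - 1"] assms show ?thesis by simp
qed

definition pharm :: "nat \<Rightarrow> nat \<Rightarrow> real" where
  "pharm i n = (\<Sum>j\<in>{1..n}. 1 / real j ^ i)"

lemma hsym_unroll: "hsym r (Suc n) = (\<Sum>i\<le>r. (1 / real (Suc n)) ^ i * hsym (r - i) n)"
proof (induction r)
  case (Suc r)
  have "(\<Sum>i\<le>Suc r. (1 / real (Suc n)) ^ i * hsym (Suc r - i) n) =
     hsym (Suc r) n + (\<Sum>i\<le>r. (1 / real (Suc n)) ^ i * hsym (r - i) n) / real (Suc n)"
    by (subst sum.atMost_Suc_shift) (simp add: sum_divide_distrib)
  then show ?case by (simp only: Suc[symmetric] hsym.simps)
qed simp

text \<open>Newton's identity, by induction on \<open>n\<close> and inside it on \<open>r\<close>.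
  Adjoining a variable \<open>x\<close> adds \<open>x ^ (i + 1)\<close> to each power sum; by
  \<open>hsym_unroll\<close> these additions recombine to \<open>x\<close> times
  \<open>hsym r (Suc n)\<close>, and the two induction hypotheses give the other terms.\<close>

lemma hsym_newton: "real r * hsym r n = (\<Sum>i<r. pharm (Suc i) n * hsym (r - 1 - i) n)"
proof (induction n arbitrary: r)
  case 0
  then show ?case by (cases r) (simp_all add: pharm_def)
next
  case (Suc n)
  note IHn = Suc
  define x where "x = 1 / real (Suc n)"
  show ?case
  proof (induction r)
    case (Suc r)
    have h: "hsym (r - i) (Suc n) = hsym (r - i) n + x * hsym (r - 1 - i) (Suc n)" if "i < r" for i
    proof -
      obtain d where "r - i = Suc d" "r - 1 - i = d" using \<open>i < r\<close> by (metis Suc_diff_Suc diff_Suc_eq_diff_pred)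
      then show ?thesis by (simp only: hsym.simps x_def) simp
    qed
    have p: "pharm (Suc i) (Suc n) = pharm (Suc i) n + x * x ^ i" for i
      by (simp add: pharm_def x_def power_divide)
    have "(\<Sum>i<Suc r. pharm (Suc i) (Suc n) * hsym (Suc r - 1 - i) (Suc n)) =
        (\<Sum>i<r. pharm (Suc i) (Suc n) * hsym (r - i) (Suc n)) + pharm (Suc r) (Suc n)"
      by simp
    also have "(\<Sum>i<r. pharm (Suc i) (Suc n) * hsym (r - i) (Suc n)) =
        (\<Sum>i<r. pharm (Suc i) (Suc n) * hsym (r - i) n + x * (pharm (Suc i) (Suc n) * hsym (r - 1 - i) (Suc n)))"
      by (intro sum.cong refl) (simp add: h algebra_simps)
    also have "\<dots> = (\<Sum>i<r. pharm (Suc i) (Suc n) * hsym (r - i) n) + x * (real r * hsym r (Suc n))"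
      by (simp only: sum.distrib sum_distrib_left[symmetric] Suc)
    also have "(\<Sum>i<r. pharm (Suc i) (Suc n) * hsym (r - i) n) + x * (real r * hsym r (Suc n)) + pharm (Suc r) (Suc n) =
        (\<Sum>i<Suc r. pharm (Suc i) (Suc n) * hsym (r - i) n) + x * (real r * hsym r (Suc n))"
      by simp
    also have "(\<Sum>i<Suc r. pharm (Suc i) (Suc n) * hsym (r - i) n) =
       (\<Sum>i<Suc r. pharm (Suc i) n * hsym (Suc r - 1 - i) n) + x * (\<Sum>i\<le>r. x ^ i * hsym (r - i) n)"
      by (simp only: p distrib_right sum.distrib sum_distrib_left lessThan_Suc_atMost) (simp add: mult.assoc)
    also have "(\<Sum>i\<le>r. x ^ i * hsym (r - i) n) = hsym r (Suc n)"
      unfolding x_def by (rule hsym_unroll[symmetric])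
    also have "(\<Sum>i<Suc r. pharm (Suc i) n * hsym (Suc r - 1 - i) n) = real (Suc r) * hsym (Suc r) n"
      by (rule IHn[symmetric])
    finally have "(\<Sum>i<Suc r. pharm (Suc i) (Suc n) * hsym (Suc r - 1 - i) (Suc n)) =
       real (Suc r) * (hsym (Suc r) n + x * hsym r (Suc n))"
      by (simp add: algebra_simps)
    then show ?case by (simp add: x_def)
  qed simp
qed

section \<open>Expansions in powers of the logarithm\<close>

text \<open>The error bound \<open>ln n ^ d / (n ln n)\<close> is the \<open>ln n ^ (d - 1) / n\<close> of the theorem,
  but without truncated subtraction it is multiplicative in \<open>d\<close>, also at \<open>d = 0\<close>.\<close>
definition log_poly :: "nat \<Rightarrow> real \<Rightarrow> (nat \<Rightarrow> real) \<Rightarrow> bool" where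
  "log_poly d c f \<longleftrightarrow> (\<exists>q. degree q \<le> d \<and> coeff q d = c \<and>
     (\<lambda>n. f n - poly q (ln (real n))) \<in> O(\<lambda>n. ln (real n) ^ d / (real n * ln (real n))))"

lemma ln_ge_1_sequentially: "eventually (\<lambda>n. 1 \<le> ln (real n)) sequentially"
  by real_asymp

lemma log_polyE:
  assumes "log_poly d c f"
  obtains q where "degree q \<le> d" "coeff q d = c"
    "(\<lambda>n. f n - poly q (ln (real n))) \<in> O(\<lambda>n. ln (real n) ^ d / (real n * ln (real n)))"
  using assms unfolding log_poly_def by blast

lemma log_poly_cong: "log_poly d c f \<Longrightarrow> (\<And>n. 2 \<le> n \<Longrightarrow> f n = g n) \<Longrightarrow> log_poly d c g"
  unfolding log_poly_def
  by (elim ex_forward conj_forward; (assumption | erule landau_o.big.in_cong[THEN iffD1, rotated]))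
     (auto intro!: eventually_sequentiallyI[of 2])

lemma log_poly_const: "log_poly 0 c (\<lambda>_. c)"
  unfolding log_poly_def by (intro exI[of _ "[:c:]"]) simp

lemma log_poly_add:
  assumes "log_poly d c f" "log_poly d c' g"
  shows "log_poly d (c + c') (\<lambda>n. f n + g n)"
proof -
  obtain p where p: "degree p \<le> d" "coeff p d = c"
    "(\<lambda>n. f n - poly p (ln (real n))) \<in> O(\<lambda>n. ln (real n) ^ d / (real n * ln (real n)))"
    using log_polyE[OF assms(1)] by blast
  obtain q where q: "degree q \<le> d" "coeff q d = c'"
    "(\<lambda>n. g n - poly q (ln (real n))) \<in> O(\<lambda>n. ln (real n) ^ d / (real n * ln (real n)))"
    using log_polyE[OF assms(2)] by blast
  have "(\<lambda>n. (f n + g n) - poly (p + q) (ln (real n))) \<in> O(\<lambda>n. ln (real n) ^ d / (real n * ln (real n)))"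
    using sum_in_bigo(1)[OF p(3) q(3)] by (simp add: algebra_simps)
  then show ?thesis unfolding log_poly_def
    using p q by (intro exI[of _ "p + q"]) (simp add: degree_add_le)
qed

lemma log_poly_cmult:
  assumes "log_poly d c f"
  shows "log_poly d (a * c) (\<lambda>n. a * f n)"
proof -
  obtain p where p: "degree p \<le> d" "coeff p d = c"
    "(\<lambda>n. f n - poly p (ln (real n))) \<in> O(\<lambda>n. ln (real n) ^ d / (real n * ln (real n)))"
    using log_polyE[OF assms(1)] by blast
  have "(\<lambda>n. a * (f n - poly p (ln (real n)))) \<in> O(\<lambda>n. ln (real n) ^ d / (real n * ln (real n)))"
    using p(3) by (cases "a = 0") simp_all
  then have "(\<lambda>n. a * f n - poly (smult a p) (ln (real n))) \<in> O(\<lambda>n. ln (real n) ^ d / (real n * ln (real n)))"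
    by (simp add: algebra_simps)
  moreover have "degree (smult a p) \<le> d" using p(1) degree_smult_le[of a p] by linarith
  ultimately show ?thesis unfolding log_poly_def
    using p by (intro exI[of _ "smult a p"]) simp
qed

lemma log_poly_Suc:
  assumes "log_poly d c f"
  shows "log_poly (Suc d) 0 f"
proof -
  obtain p where p: "degree p \<le> d" "coeff p d = c"
    "(\<lambda>n. f n - poly p (ln (real n))) \<in> O(\<lambda>n. ln (real n) ^ d / (real n * ln (real n)))"
    using log_polyE[OF assms(1)] by blast
  have "(\<lambda>n. ln (real n) ^ d / (real n * ln (real n))) \<in> O(\<lambda>n. ln (real n) ^ Suc d / (real n * ln (real n)))"
  proof (rule bigoI[of _ 1])
    show "eventually (\<lambda>n. norm (ln (real n) ^ d / (real n * ln (real n))) \<le>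
       1 * norm (ln (real n) ^ Suc d / (real n * ln (real n)))) sequentially"
      using ln_ge_1_sequentially
    proof eventually_elim
      case (elim n)
      have "ln (real n) ^ d \<le> ln (real n) ^ Suc d" using elim by (intro power_increasing) auto
      then have "ln (real n) ^ d / (real n * ln (real n)) \<le> ln (real n) ^ Suc d / (real n * ln (real n))"
        using elim by (intro divide_right_mono) auto
      moreover have "0 \<le> ln (real n) ^ d / (real n * ln (real n))" using elim by simp
      ultimately show ?case by (simp only: real_norm_def abs_of_nonneg mult_1 order.trans)
    qed
  qed
  from landau_o.big_trans[OF p(3) this] show ?thesis unfolding log_poly_def
    using p by (intro exI[of _ p]) (auto simp: coeff_eq_0)
qed

lemma log_poly_mono: "log_poly d c f \<Longrightarrow> d < e \<Longrightarrow> log_poly e 0 f"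
proof (induction e)
  case (Suc e)
  then show ?case by (cases "d = e") (auto intro: log_poly_Suc)
qed simp

lemma poly_ln_bigo:
  assumes "degree p \<le> d"
  shows "(\<lambda>n. poly p (ln (real n))) \<in> O(\<lambda>n. ln (real n) ^ d)"
proof -
  have "(\<lambda>n. coeff p i * ln (real n) ^ i) \<in> O(\<lambda>n. ln (real n) ^ d)" if "i \<le> d" for i
  proof (rule bigoI[of _ "\<bar>coeff p i\<bar>"])
    show "eventually (\<lambda>n. norm (coeff p i * ln (real n) ^ i) \<le>
       \<bar>coeff p i\<bar> * norm (ln (real n) ^ d)) sequentially"
      using ln_ge_1_sequentially
    proof eventually_elim
      case (elim n)
      have "ln (real n) ^ i \<le> ln (real n) ^ d" using elim that by (intro power_increasing) auto
      then show ?case using elim by (auto simp: abs_mult intro!: mult_left_mono)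
    qed
  qed
  then show ?thesis
    unfolding poly_altdef using assms by (intro big_sum_in_bigo) auto
qed

text \<open>The error splits as \<open>(f - p) g + p (g - q)\<close>, where \<open>g\<close> is of
  order \<open>ln n ^ e\<close> and \<open>p\<close> of order \<open>ln n ^ d\<close>.\<close>

lemma log_poly_mult:
  assumes "log_poly d c f" "log_poly e c' g"
  shows "log_poly (d + e) (c * c') (\<lambda>n. f n * g n)"
proof -
  define L where "L d n = ln (real n) ^ d / (real n * ln (real n))" for d n
  obtain p where p: "degree p \<le> d" "coeff p d = c" "(\<lambda>n. f n - poly p (ln (real n))) \<in> O(L d)"
    using log_polyE[OF assms(1)] unfolding L_def by blast
  obtain q where q: "degree q \<le> e" "coeff q e = c'" "(\<lambda>n. g n - poly q (ln (real n))) \<in> O(L e)"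
    using log_polyE[OF assms(2)] unfolding L_def by blast
  have "L e \<in> O(\<lambda>n. ln (real n) ^ e)"
  proof (rule bigoI[of _ 1])
    show "eventually (\<lambda>n. norm (L e n) \<le> 1 * norm (ln (real n) ^ e)) sequentially"
      using ln_ge_1_sequentially eventually_ge_at_top[of 1]
    proof eventually_elim
      case (elim n)
      have "1 * 1 \<le> real n * ln (real n)" using elim by (intro mult_mono) auto
      then have "ln (real n) ^ e / (real n * ln (real n)) \<le> ln (real n) ^ e / 1"
        using elim by (intro divide_left_mono) auto
      then show ?case using elim by (simp add: L_def)
    qed
  qed
  then have gb: "g \<in> O(\<lambda>n. ln (real n) ^ e)"
    using sum_in_bigo(1)[OF landau_o.big_trans[OF q(3)] poly_ln_bigo[OF q(1)]] by simp
  have "(\<lambda>n. (f n - poly p (ln (real n))) * g n) \<in> O(\<lambda>n. L d n * ln (real n) ^ e)"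
    by (rule landau_o.big.mult[OF p(3) gb])
  moreover have "(\<lambda>n. poly p (ln (real n)) * (g n - poly q (ln (real n)))) \<in> O(\<lambda>n. ln (real n) ^ d * L e n)"
    by (rule landau_o.big.mult[OF poly_ln_bigo[OF p(1)] q(3)])
  ultimately have "(\<lambda>n. (f n - poly p (ln (real n))) * g n + poly p (ln (real n)) * (g n - poly q (ln (real n))))
     \<in> O(L (d + e))"
    by (intro sum_in_bigo(1)) (simp_all add: L_def[abs_def] power_add)
  then have "(\<lambda>n. f n * g n - poly (p * q) (ln (real n))) \<in> O(L (d + e))"
    by (simp add: algebra_simps)
  moreover have "degree (p * q) \<le> d + e"
    using degree_mult_le[of p q] p(1) q(1) by linarith
  moreover have "coeff (p * q) (d + e) = c * c'"
  proof -
    have "coeff p i * coeff q (d + e - i) = 0" if "i \<le> d + e" "i \<noteq> d" for i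
      using that p(1) q(1) by (cases "i < d") (auto simp: coeff_eq_0)
    then have "coeff (p * q) (d + e) = (\<Sum>i\<in>{d}. coeff p i * coeff q (d + e - i))"
      unfolding coeff_mult by (intro sum.mono_neutral_right) auto
    then show ?thesis using p q by simp
  qed
  ultimately show ?thesis unfolding log_poly_def L_def[abs_def] by blast
qed

lemma log_poly_sum:
  "finite A \<Longrightarrow> (\<And>i. i \<in> A \<Longrightarrow> log_poly d 0 (f i)) \<Longrightarrow> 0 < d \<Longrightarrow> log_poly d 0 (\<lambda>n. \<Sum>i\<in>A. f i n)"
proof (induction A rule: finite_induct)
  case empty
  show ?case using log_poly_mono[OF log_poly_const[of 0], of d] empty by simp
next
  case (insert x F)
  then show ?case using log_poly_add[of d 0 "f x" 0 "\<lambda>n. \<Sum>i\<in>F. f i n"] by simp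
qed

text \<open>An error of order \<open>1 / n\<close> is the case \<open>d = 1\<close> of the error
  bound. Sequences that converge at this rate are therefore treated as degree 1 with leading
  coefficient 0.\<close>

lemma log_poly_inverse:
  assumes p: "degree p \<le> 1" "coeff p 1 = c"
    and f: "\<And>n. 2 \<le> n \<Longrightarrow> \<bar>f n - poly p (ln (real n))\<bar> \<le> C / real (n - 1)"
  shows "log_poly 1 c f"
proof -
  have "(\<lambda>n. f n - poly p (ln (real n))) \<in> O(\<lambda>n. ln (real n) ^ 1 / (real n * ln (real n)))"
  proof (rule bigoI[of _ "2 * \<bar>C\<bar>"])
    show "eventually (\<lambda>n. norm (f n - poly p (ln (real n))) \<le>
       2 * \<bar>C\<bar> * norm (ln (real n) ^ 1 / (real n * ln (real n)))) sequentially"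
      using ln_ge_1_sequentially eventually_ge_at_top[of 2]
    proof eventually_elim
      case (elim n)
      have "\<bar>f n - poly p (ln (real n))\<bar> \<le> C / real (n - 1)" using f elim by simp
      also have "\<dots> \<le> \<bar>C\<bar> / real (n - 1)" by (intro divide_right_mono) auto
      also have "\<dots> \<le> \<bar>C\<bar> / (real n / 2)"
        using elim by (intro divide_left_mono) auto
      finally show ?case using elim by (simp add: mult.commute)
    qed
  qed
  then show ?thesis unfolding log_poly_def using p by blast
qed

section \<open>Asymptotics of power sums and complete homogeneous sums\<close>

text \<open>Since \<open>1 / n ^ 2\<close> is at most \<open>1 / (n - 1) - 1 / n\<close>, the
  increments telescope; this gives both the Cauchy property and the explicit rate.\<close>

lemma tail_limit:
  fixes g :: "nat \<Rightarrow> real"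
  assumes "\<And>n. 2 \<le> n \<Longrightarrow> \<bar>g (Suc n) - g n\<bar> \<le> 1 / real n ^ 2"
  shows "\<exists>c. \<forall>n\<ge>2. \<bar>g n - c\<bar> \<le> 1 / real (n - 1)"
proof -
  have step: "1 / real n ^ 2 \<le> 1 / real (n - 1) - 1 / real n" if "2 \<le> n" for n
  proof -
    have "1 / real (n - 1) - 1 / real n = 1 / (real (n - 1) * real n)"
      using that by (simp add: field_simps of_nat_diff)
    moreover have "real (n - 1) * real n \<le> real n ^ 2"
      unfolding power2_eq_square by (intro mult_right_mono) auto
    ultimately show ?thesis using that by (simp add: frac_le)
  qed
  have bound: "\<bar>g m - g n\<bar> \<le> 1 / real (n - 1) - 1 / real (m - 1)" if "2 \<le> n" "n \<le> m" for m n
    using that(2)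
  proof (induction m rule: dec_induct)
    case (step m)
    then show ?case using assms[of m] \<open>\<And>n. 2 \<le> n \<Longrightarrow> 1 / real n ^ 2 \<le> 1 / real (n - 1) - 1 / real n\<close>[of m] that(1)
      by simp
  qed simp
  have bound': "\<bar>g m - g n\<bar> \<le> 1 / real (n - 1)" if "2 \<le> n" "n \<le> m" for m n
    using bound[OF that] by (smt (verit) of_nat_0_le_iff zero_le_divide_1_iff)
  have "Cauchy g"
  proof (rule CauchyI)
    fix e :: real assume "0 < e"
    then obtain M where M: "M \<noteq> 0" "1 / real M < e / 2"
      using real_arch_inverse[of "e / 2"] by (auto simp: inverse_eq_divide)
    have "norm (g m - g n) < e" if "Suc M \<le> m" "Suc M \<le> n" for m n
    proof -
      have "\<bar>g m - g (Suc M)\<bar> \<le> 1 / real M" "\<bar>g n - g (Suc M)\<bar> \<le> 1 / real M"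
        using bound'[of "Suc M"] that M by simp_all
      then show ?thesis using M unfolding real_norm_def by linarith
    qed
    then show "\<exists>M. \<forall>m\<ge>M. \<forall>n\<ge>M. norm (g m - g n) < e" by blast
  qed
  then obtain c where c: "g \<longlonglongrightarrow> c" using Cauchy_convergent convergent_def by blast
  have "\<bar>g n - c\<bar> \<le> 1 / real (n - 1)" if "2 \<le> n" for n
  proof -
    have "(\<lambda>m. \<bar>g m - g n\<bar>) \<longlonglongrightarrow> \<bar>c - g n\<bar>" by (intro tendsto_intros c)
    then have "\<bar>c - g n\<bar> \<le> 1 / real (n - 1)"
      using bound'[OF that] by (intro LIMSEQ_le_const2) auto
    then show ?thesis by (simp add: abs_minus_commute)
  qed
  then show ?thesis by blast
qed

lemma ln_Suc_diff_bound:
  assumes "1 \<le> n"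
  shows "\<bar>1 / real n - (ln (real (Suc n)) - ln (real n))\<bar> \<le> 1 / real n ^ 2"
proof -
  have e: "ln (real (Suc n)) - ln (real n) = ln (1 + 1 / real n)"
  proof -
    have "real (Suc n) = real n * (1 + 1 / real n)" using assms by (simp add: field_simps)
    moreover have "ln (real n * (1 + 1 / real n)) = ln (real n) + ln (1 + 1 / real n)"
      using assms by (intro ln_mult_pos) (auto intro: add_pos_nonneg)
    ultimately show ?thesis by simp
  qed
  have "ln (1 + 1 / real n) \<le> 1 / real n" by (rule ln_add_one_self_le_self) simp
  moreover have "1 / real n - (1 / real n)\<^sup>2 \<le> ln (1 + 1 / real n)"
    using assms by (intro ln_one_plus_pos_lower_bound) auto
  ultimately show ?thesis unfolding e by (simp add: power_one_over)
qed

text \<open>The limit \<open>c\<close> of \<open>pharm (Suc 0) (n - 1) - ln n\<close> is Euler's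
  constant, and the polynomial is \<open>X + c\<close>.\<close>

lemma log_poly_pharm_1: "log_poly 1 1 (\<lambda>n. pharm (Suc 0) (n - 1))"
proof -
  have "\<bar>(pharm (Suc 0) (Suc n - 1) - ln (real (Suc n))) - (pharm (Suc 0) (n - 1) - ln (real n))\<bar> \<le> 1 / real n ^ 2"
    if n: "2 \<le> n" for n
  proof -
    obtain m where m: "n = Suc m" using n by (cases n) auto
    then have "pharm (Suc 0) (Suc n - 1) = pharm (Suc 0) (n - 1) + 1 / real n" by (simp add: pharm_def)
    then show ?thesis using ln_Suc_diff_bound[of n] n by simp
  qed
  then obtain c where c: "\<And>n. 2 \<le> n \<Longrightarrow> \<bar>pharm (Suc 0) (n - 1) - ln (real n) - c\<bar> \<le> 1 / real (n - 1)"
    using tail_limit[of "\<lambda>n. pharm (Suc 0) (n - 1) - ln (real n)"] by blast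
  show ?thesis
    by (rule log_poly_inverse[of "[:c, 1:]" _ _ 1]) (use c in \<open>simp_all add: algebra_simps\<close>)
qed

lemma log_poly_pharm: "log_poly 1 0 (\<lambda>n. pharm (Suc (Suc i)) (n - 1))"
proof -
  have "\<bar>pharm (Suc (Suc i)) (Suc n - 1) - pharm (Suc (Suc i)) (n - 1)\<bar> \<le> 1 / real n ^ 2"
    if n: "2 \<le> n" for n
  proof -
    obtain m where m: "n = Suc m" using n by (cases n) auto
    then have "pharm (Suc (Suc i)) (Suc n - 1) - pharm (Suc (Suc i)) (n - 1) = 1 / real n ^ Suc (Suc i)"
      by (simp add: pharm_def)
    moreover have "real n ^ 2 \<le> real n ^ Suc (Suc i)" using n by (intro power_increasing) auto
    ultimately show ?thesis using n by (simp add: frac_le)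
  qed
  then obtain c where c: "\<And>n. 2 \<le> n \<Longrightarrow> \<bar>pharm (Suc (Suc i)) (n - 1) - c\<bar> \<le> 1 / real (n - 1)"
    using tail_limit[of "\<lambda>n. pharm (Suc (Suc i)) (n - 1)"] by blast
  show ?thesis
    by (rule log_poly_inverse[of "[:c:]" _ _ 1]) (use c in simp_all)
qed

text \<open>In Newton's identity only the first power sum contributes a logarithm. Every other
  product has degree at most \<open>r - 1\<close>, so the leading coefficient is
  \<open>1 / r\<close> times that of degree \<open>r - 1\<close>.\<close>

lemma log_poly_hsym: "log_poly r (1 / fact r) (\<lambda>n. hsym r (n - 1))"
proof (induction r rule: less_induct)
  case (less r)
  show ?case
  proof (cases r)
    case 0
    then show ?thesis using log_poly_const[of 1] by simp
  next
    case (Suc m)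
    have "{..<r} = insert 0 {1..<r}" using Suc by auto
    then have N: "real r * hsym r n = pharm (Suc 0) n * hsym m n +
        (\<Sum>i\<in>{1..<r}. pharm (Suc i) n * hsym (r - 1 - i) n)" for n
      by (subst hsym_newton) (simp add: Suc)
    have "log_poly r 0 (\<lambda>n. pharm (Suc i) (n - 1) * hsym (r - 1 - i) (n - 1))" if i: "i \<in> {1..<r}" for i
    proof -
      obtain k where k: "i = Suc k" using i by (cases i) auto
      have "log_poly (1 + (r - 1 - i)) (0 * (1 / fact (r - 1 - i)))
          (\<lambda>n. pharm (Suc i) (n - 1) * hsym (r - 1 - i) (n - 1))"
        unfolding k using i k by (intro log_poly_mult log_poly_pharm less) auto
      then show ?thesis by (rule log_poly_mono) (use i in auto)
    qed
    then have "log_poly r 0 (\<lambda>n. \<Sum>i\<in>{1..<r}. pharm (Suc i) (n - 1) * hsym (r - 1 - i) (n - 1))"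
      using Suc by (intro log_poly_sum) auto
    moreover have "log_poly r (1 / fact m) (\<lambda>n. pharm (Suc 0) (n - 1) * hsym m (n - 1))"
      using log_poly_mult[OF log_poly_pharm_1 less[of m]] Suc by simp
    ultimately have "log_poly r (1 / fact m + 0) (\<lambda>n. real r * hsym r (n - 1))"
      unfolding N by (rule log_poly_add[rotated])
    from log_poly_cmult[OF this, of "1 / real r"]
    have "log_poly r (1 / real r * (1 / fact m + 0)) (\<lambda>n. 1 / real r * (real r * hsym r (n - 1)))" .
    moreover have "1 / real r * (1 / fact m + 0) = 1 / fact r" by (simp add: Suc)
    moreover have "1 / real r * (real r * x) = x" for x using Suc by simp
    ultimately show ?thesis by (simp only:)
  qed
qed

section \<open>Alternating sums of the decomposed powers\<close>

text \<open>The constant is \<open>u 1\<close>, the value at \<open>s = 0\<close>. The error is an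
  \<open>n\<close>-th difference at index 1, bounded through \<open>u 0\<close>, the value at
  \<open>s = -1\<close>.\<close>

lemma log_poly_altsum_icm:
  assumes "cm u"
  shows "log_poly 1 0 (\<lambda>n. altsum (n - 1) (\<lambda>s. u (Suc s)))"
proof (rule log_poly_inverse[of "[:u 1:]" _ _ "u 0"])
  fix n :: nat assume n: "2 \<le> n"
  have "(bdiff ^^ (n - 1)) u 1 \<le> u 0 / real n"
    using cm_funpow_bdiff_le[OF assms, of "n - 1"] n by simp
  also have "\<dots> \<le> u 0 / real (n - 1)"
    using n cm_nonneg[OF assms, of 0] by (intro divide_left_mono) auto
  finally have "(bdiff ^^ (n - 1)) u 1 \<le> u 0 / real (n - 1)" .
  moreover have "0 \<le> (bdiff ^^ (n - 1)) u 1" using assms by (simp add: cm_def)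
  ultimately show "\<bar>altsum (n - 1) (\<lambda>s. u (Suc s)) - poly [:u 1:] (ln (real n))\<bar> \<le> u 0 / real (n - 1)"
    by (simp add: altsum_bdiff)
qed simp_all

text \<open>The powers of \<open>1 / s\<close> up to \<open>k\<close> yield \<open>hsym\<close> of
  degree at most \<open>k\<close>, and the remainders yield constants up to \<open>O(1/n)\<close>.
  Everything thus stays below degree \<open>k + 1\<close>.\<close>

lemma log_poly_altsum_laurent:
  assumes "laurent_icm k f"
  shows "log_poly (Suc k) 0 (\<lambda>n. altsum (n - 1) f)"
proof -
  obtain q u v where q: "degree q \<le> k" and uv: "icm 0 u" "icm 0 v"
    and f: "\<And>s. 1 \<le> s \<Longrightarrow> f s = poly q (1 / real s) + u (Suc s) - v (Suc s)"
    using laurent_icmE[OF assms] by metis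
  have lift: "log_poly (Suc k) 0 g" if "log_poly 1 0 g" for g
    using that by (cases k) (auto intro: log_poly_mono)
  have "log_poly (Suc k) 0 (\<lambda>n. \<Sum>i\<le>degree q. coeff q i * hsym i (n - 1))"
  proof (rule log_poly_sum)
    fix i assume "i \<in> {..degree q}"
    then show "log_poly (Suc k) 0 (\<lambda>n. coeff q i * hsym i (n - 1))"
      using q by (intro log_poly_mono[OF log_poly_cmult[OF log_poly_hsym]]) auto
  qed auto
  moreover note lift[OF log_poly_altsum_icm[of u]]
  moreover have "log_poly (Suc k) (- 1 * 0) (\<lambda>n. - 1 * altsum (n - 1) (\<lambda>s. v (Suc s)))"
    using uv by (intro log_poly_cmult lift log_poly_altsum_icm) simp
  ultimately have "log_poly (Suc k) (0 + 0 + - 1 * 0) (\<lambda>n. (\<Sum>i\<le>degree q. coeff q i * hsym i (n - 1)) +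
     altsum (n - 1) (\<lambda>s. u (Suc s)) + - 1 * altsum (n - 1) (\<lambda>s. v (Suc s)))"
    using uv by (intro log_poly_add) auto
  then have "log_poly (Suc k) 0 (\<lambda>n. (\<Sum>i\<le>degree q. coeff q i * hsym i (n - 1)) +
     altsum (n - 1) (\<lambda>s. u (Suc s)) + - 1 * altsum (n - 1) (\<lambda>s. v (Suc s)))"
    by (simp only: add_0_right mult_zero_right)
  then show ?thesis
  proof (rule log_poly_cong)
    fix n :: nat assume n: "2 \<le> n"
    have "altsum (n - 1) f = altsum (n - 1) (\<lambda>s. (\<Sum>i\<le>degree q. coeff q i * (1 / real s ^ i)) + u (Suc s) - v (Suc s))"
      by (rule altsum_cong) (simp add: f poly_altdef power_one_over)
    also have "\<dots> = (\<Sum>i\<le>degree q. coeff q i * hsym i (n - 1)) + altsum (n - 1) (\<lambda>s. u (Suc s)) +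
        - 1 * altsum (n - 1) (\<lambda>s. v (Suc s))"
      using n by (simp only: altsum_diff altsum_add altsum_sum altsum_cmult) (simp add: altsum_inverse_power)
    finally show "(\<Sum>i\<le>degree q. coeff q i * hsym i (n - 1)) + altsum (n - 1) (\<lambda>s. u (Suc s)) +
        - 1 * altsum (n - 1) (\<lambda>s. v (Suc s)) = altsum (n - 1) f" ..
  qed
qed

lemma log_poly_altsum_harm:
  "log_poly k ((6 / pi\<^sup>2) ^ k / fact k) (\<lambda>n. altsum (n - 1) (\<lambda>s. 1 / harm s ^ k))"
  if k1: "1 \<le> k"
proof -
  obtain l where k: "k = Suc l" using k1 by (cases k) auto
  define a :: real where "a = 6 / pi\<^sup>2"
  have "log_poly k (a ^ k * (1 / fact k) + 0) (\<lambda>n. a ^ k * hsym k (n - 1) +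
     altsum (n - 1) (\<lambda>s. 1 / harm s ^ k - (a / real s) ^ k))"
    unfolding k a_def
    by (intro log_poly_add log_poly_cmult log_poly_hsym log_poly_altsum_laurent laurent_icm_harm_power)
  then have "log_poly k (a ^ k / fact k) (\<lambda>n. a ^ k * hsym k (n - 1) +
     altsum (n - 1) (\<lambda>s. 1 / harm s ^ k - (a / real s) ^ k))" by simp
  then show ?thesis
    unfolding a_def[symmetric]
  proof (rule log_poly_cong)
    fix n :: nat assume n: "2 \<le> n"
    have "altsum (n - 1) (\<lambda>s. (a / real s) ^ k) = a ^ k * altsum (n - 1) (\<lambda>s. 1 / real s ^ k)"
      unfolding altsum_cmult[symmetric] by (simp add: power_divide)
    also have "\<dots> = a ^ k * hsym k (n - 1)" using n by (simp add: altsum_inverse_power)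
    finally show "a ^ k * hsym k (n - 1) + altsum (n - 1) (\<lambda>s. 1 / harm s ^ k - (a / real s) ^ k) =
       altsum (n - 1) (\<lambda>s. 1 / harm s ^ k)"
      by (simp add: altsum_diff)
  qed
qed

section \<open>The moments of the absorption time\<close>

declare jpath.simps [simp del]

section \<open>Moments along a fixed path\<close>

text \<open>The \<open>k\<close>-th moment of a sum of independent exponential times, by the
  binomial theorem and the moments \<open>i! / rate ^ i\<close>.\<close>

fun path_moment :: "nat list \<Rightarrow> nat \<Rightarrow> real" where
  "path_moment [] k = (if k = 0 then 1 else 0)"
| "path_moment (m # p) k =
     (\<Sum>i\<le>k. real (k choose i) * (fact i / harm (m - 1) ^ i) * path_moment p (k - i))"

lemma path_moment_nonneg: "0 \<le> path_moment p k"
  by (induction p arbitrary: k) (auto intro!: sum_nonneg mult_nonneg_nonneg divide_nonneg_nonneg zero_le_power harm_nonneg)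

lemma path_moment_0: "path_moment p 0 = 1"
  by (induction p) simp_all

text \<open>The analogue of integration by parts for the first holding time. The term
  \<open>i = 0\<close> is the moment of the rest of the path; absorption turns the other terms into
  the lower moment of the whole path.\<close>

lemma path_moment_Cons_Suc:
  "path_moment (m # p) (Suc k) =
     real (Suc k) / harm (m - 1) * path_moment (m # p) k + path_moment p (Suc k)"
proof -
  have c: "real (Suc k choose Suc i) * fact (Suc i) = real (Suc k) * (real (k choose i) * fact i)" for i
  proof -
    have "real (Suc k) * real (k choose i) = real (Suc k choose Suc i) * real (Suc i)"
      using Suc_times_binomial_eq[of k i] by (metis of_nat_mult)
    then show ?thesis by (simp only: fact_Suc of_nat_mult mult_ac)
  qed
  have "(\<Sum>i\<le>k. real (Suc k choose Suc i) * (fact (Suc i) / harm (m - 1) ^ Suc i) * path_moment p (Suc k - Suc i)) =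
      (\<Sum>i\<le>k. real (Suc k) / harm (m - 1) * (real (k choose i) * (fact i / harm (m - 1) ^ i) * path_moment p (k - i)))"
  proof (rule sum.cong[OF refl])
    fix i
    have "real (Suc k choose Suc i) * (fact (Suc i) / harm (m - 1) ^ Suc i) * path_moment p (Suc k - Suc i) =
      (real (Suc k choose Suc i) * fact (Suc i)) / (harm (m - 1) * harm (m - 1) ^ i) * path_moment p (k - i)"
      by simp
    then show "real (Suc k choose Suc i) * (fact (Suc i) / harm (m - 1) ^ Suc i) * path_moment p (Suc k - Suc i) =
      real (Suc k) / harm (m - 1) * (real (k choose i) * (fact i / harm (m - 1) ^ i) * path_moment p (k - i))"
      unfolding c by simp
  qed
  then show ?thesis
    unfolding path_moment.simps by (subst sum.atMost_Suc_shift) (simp add: sum_distrib_left)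
qed

lemma nn_integral_exponential_moment:
  assumes "0 < l"
  shows "(\<integral>\<^sup>+ x. ennreal (x ^ i) \<partial>density lborel (exponential_density l)) = ennreal (fact i / l ^ i)"
proof -
  have "(\<integral>\<^sup>+ x. ennreal (x ^ i) \<partial>density lborel (exponential_density l)) =
     (\<integral>\<^sup>+ x. ennreal (exponential_density l x * x ^ i) \<partial>lborel)"
    using assms by (subst nn_integral_density) (auto simp: ennreal_mult' exponential_density_nonneg)
  also have "\<dots> = ennreal (fact i / l ^ i)"
    using nn_integral_erlang_ith_moment[OF assms, of 0 i] by simp
  finally show ?thesis .
qed

lemma AE_exponential_nonneg: "AE x in density lborel (exponential_density l). 0 \<le> x"
  by (subst AE_density) (auto simp: exponential_density_def)

text \<open>The law \<open>holding_law\<close> is a kernel on all lists, including those with an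
  entry whose rate is \<open>harm 0 = 0\<close>. There the density is zero, and the bound by 1 still
  makes the kernel subprobabilistic.\<close>

lemma emeasure_exponential_le_1:
  assumes "0 \<le> l"
  shows "emeasure (density lborel (exponential_density l)) UNIV \<le> 1"
proof (cases "l = 0")
  case True
  then have "exponential_density l = (\<lambda>_. 0)" by (simp add: fun_eq_iff exponential_density_def)
  then show ?thesis by (simp add: emeasure_density)
next
  case False
  then interpret prob_space "density lborel (exponential_density l)"
    using assms by (intro prob_space_exponential_density) simp
  show ?thesis using emeasure_le_1[of UNIV] by simp
qed

lemma sets_holding_law: "sets (holding_law p) = sets borel"
  by (cases p) (simp_all add: holding_law_def)

lemma holding_law_Cons:
  "holding_law (m # p) = (density lborel (exponential_density (harm (m - 1))) \<star> holding_law p)"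
  by (simp add: holding_law_def)

lemma emeasure_holding_law_le_1: "emeasure (holding_law p) UNIV \<le> 1"
proof (induction p)
  case Nil
  then show ?case by (simp add: holding_law_def)
next
  case (Cons m p)
  let ?E = "density lborel (exponential_density (harm (m - 1)))"
  have E: "emeasure ?E UNIV \<le> 1" by (intro emeasure_exponential_le_1 harm_nonneg)
  have fE: "finite_measure ?E" using E by (intro finite_measureI) (auto simp: top_unique)
  have sp: "space (holding_law p) = UNIV" using sets_eq_imp_space_eq[OF sets_holding_law] by simp
  have fM: "finite_measure (holding_law p)" using Cons by (intro finite_measureI) (auto simp: top_unique sp)
  have "emeasure (holding_law (m # p)) UNIV = (\<integral>\<^sup>+ x. 1 \<partial>(?E \<star> holding_law p))"
    by (simp add: holding_law_Cons)
  also have "\<dots> = (\<integral>\<^sup>+ x. \<integral>\<^sup>+ y. 1 \<partial>holding_law p \<partial>?E)"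
    by (rule nn_integral_convolution[OF fE fM sets_holding_law]) simp_all
  also have "\<dots> = emeasure (holding_law p) UNIV * emeasure ?E UNIV"
    by (simp add: sp)
  also have "\<dots> \<le> 1 * 1" by (intro mult_mono Cons E) auto
  finally show ?case by simp
qed

lemma space_holding_law: "space (holding_law p) = UNIV"
  using sets_eq_imp_space_eq[OF sets_holding_law] by simp

lemma holding_law_subprob: "holding_law p \<in> space (subprob_algebra borel)"
  using emeasure_holding_law_le_1[of p]
  by (simp add: space_subprob_algebra sets_holding_law space_holding_law subprob_spaceI)

lemma finite_holding_law: "finite_measure (holding_law p)"
  using emeasure_holding_law_le_1[of p]
  by (intro finite_measureI) (auto simp: top_unique space_holding_law)

lemma finite_exponential: "0 \<le> l \<Longrightarrow> finite_measure (density lborel (exponential_density l))"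
  using emeasure_exponential_le_1[of l] by (intro finite_measureI) (auto simp: top_unique)

text \<open>Nonnegativity is restated as a vanishing integral, since the integral rules for
  convolutions and for bind can then be applied.\<close>

lemma AE_borel_nonneg_iff:
  assumes "sets M = sets borel"
  shows "(AE x in M. 0 \<le> (x::real)) \<longleftrightarrow> (\<integral>\<^sup>+ x. indicator {..<0} x \<partial>M) = 0"
proof -
  have "indicator {..<0::real} \<in> borel_measurable M"
    by (subst measurable_cong_sets[OF assms refl]) simp
  then have "(\<integral>\<^sup>+ x. indicator {..<0::real} x \<partial>M) = 0 \<longleftrightarrow> (AE x in M. indicator {..<0::real} x = (0::ennreal))"
    by (rule nn_integral_0_iff_AE)
  also have "\<dots> \<longleftrightarrow> (AE x in M. 0 \<le> x)"
    by (intro AE_cong) (auto simp: indicator_def)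
  finally show ?thesis by simp
qed

lemma holding_law_nonneg: "AE x in holding_law p. 0 \<le> x"
proof (induction p)
  case Nil
  show ?case
    by (subst AE_borel_nonneg_iff[OF sets_holding_law]) (simp add: holding_law_def nn_integral_return)
next
  case (Cons m p)
  let ?E = "density lborel (exponential_density (harm (m - 1)))"
  have "(\<integral>\<^sup>+ x. indicator {..<0} x \<partial>holding_law (m # p)) =
      (\<integral>\<^sup>+ x. \<integral>\<^sup>+ y. indicator {..<0} (x + y) \<partial>holding_law p \<partial>?E)"
    unfolding holding_law_Cons
    by (rule nn_integral_convolution[OF finite_exponential[OF harm_nonneg] finite_holding_law sets_holding_law]) simp_all
  also have "\<dots> = (\<integral>\<^sup>+ x. 0 \<partial>?E)"
  proof (rule nn_integral_cong_AE)
    show "AE x in ?E. (\<integral>\<^sup>+ y. indicator {..<0} (x + y) \<partial>holding_law p) = 0"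
      using AE_exponential_nonneg
    proof eventually_elim
      case (elim x)
      have "(\<integral>\<^sup>+ y. indicator {..<0} (x + y) \<partial>holding_law p) = (\<integral>\<^sup>+ y. 0 \<partial>holding_law p)"
        using Cons elim by (intro nn_integral_cong_AE) (auto elim!: eventually_mono)
      then show ?case by simp
    qed
  qed
  finally show ?case by (subst AE_borel_nonneg_iff) (simp_all add: sets_holding_law)
qed

text \<open>Since \<open>ennreal\<close> cuts off negative values, the binomial expansion under the
  integral relies on both summands being nonnegative almost everywhere. Entries of at least 2 make
  every rate positive.\<close>

lemma nn_integral_holding_law:
  assumes "\<forall>m\<in>set p. 2 \<le> m"
  shows "(\<integral>\<^sup>+ x. ennreal (x ^ k) \<partial>holding_law p) = ennreal (path_moment p k)"
  using assms
proof (induction p arbitrary: k)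
  case Nil
  then show ?case by (simp add: holding_law_def nn_integral_return power_0_left)
next
  case (Cons m p)
  let ?h = "harm (m - 1) :: real"
  let ?E = "density lborel (exponential_density ?h)"
  let ?M = "holding_law p"
  have h: "0 < ?h" using Cons.prems by (intro harm_pos_nat) auto
  have IH: "(\<integral>\<^sup>+ x. ennreal (x ^ k) \<partial>?M) = ennreal (path_moment p k)" for k
    using Cons by simp
  have meas[measurable_cong]: "sets ?M = sets borel" by (rule sets_holding_law)
  have "(\<integral>\<^sup>+ x. ennreal (x ^ k) \<partial>holding_law (m # p)) =
      (\<integral>\<^sup>+ x. \<integral>\<^sup>+ y. ennreal ((x + y) ^ k) \<partial>?M \<partial>?E)"
    unfolding holding_law_Cons
    by (rule nn_integral_convolution[OF finite_exponential[OF harm_nonneg] finite_holding_law sets_holding_law]) simp_all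
  also have "\<dots> = (\<integral>\<^sup>+ x. (\<Sum>i\<le>k. ennreal (real (k choose i) * path_moment p (k - i)) * ennreal (x ^ i)) \<partial>?E)"
  proof (rule nn_integral_cong_AE)
    show "AE x in ?E. (\<integral>\<^sup>+ y. ennreal ((x + y) ^ k) \<partial>?M) =
        (\<Sum>i\<le>k. ennreal (real (k choose i) * path_moment p (k - i)) * ennreal (x ^ i))"
      using AE_exponential_nonneg
    proof eventually_elim
      case (elim x)
      have "(\<integral>\<^sup>+ y. ennreal ((x + y) ^ k) \<partial>?M) =
         (\<integral>\<^sup>+ y. (\<Sum>i\<le>k. ennreal (real (k choose i) * x ^ i) * ennreal (y ^ (k - i))) \<partial>?M)"
      proof (rule nn_integral_cong_AE)
        show "AE y in ?M. ennreal ((x + y) ^ k) =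
            (\<Sum>i\<le>k. ennreal (real (k choose i) * x ^ i) * ennreal (y ^ (k - i)))"
          using holding_law_nonneg
        proof eventually_elim
          case (elim y)
          then show ?case using \<open>0 \<le> x\<close>
            by (simp add: binomial_ring ennreal_mult[symmetric] sum_ennreal)
        qed
      qed
      also have "\<dots> = (\<Sum>i\<le>k. ennreal (real (k choose i) * x ^ i) * (\<integral>\<^sup>+ y. ennreal (y ^ (k - i)) \<partial>?M))"
        by (subst nn_integral_sum) (auto simp: nn_integral_cmult)
      also have "\<dots> = (\<Sum>i\<le>k. ennreal (real (k choose i) * path_moment p (k - i)) * ennreal (x ^ i))"
        unfolding IH using elim
        by (intro sum.cong refl) (simp add: ennreal_mult[symmetric] path_moment_nonneg mult_ac)
      finally show ?case .
    qed
  qed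
  also have "\<dots> = (\<Sum>i\<le>k. ennreal (real (k choose i) * path_moment p (k - i)) * ennreal (fact i / ?h ^ i))"
    by (subst nn_integral_sum) (auto simp: nn_integral_cmult nn_integral_exponential_moment[OF h] simp del: One_nat_def)
  also have "\<dots> = (\<Sum>i\<le>k. ennreal (real (k choose i) * (fact i / ?h ^ i) * path_moment p (k - i)))"
  proof (rule sum.cong[OF refl])
    fix i
    have "0 \<le> fact i / ?h ^ i" by (intro divide_nonneg_nonneg zero_le_power harm_nonneg) simp
    then show "ennreal (real (k choose i) * path_moment p (k - i)) * ennreal (fact i / ?h ^ i) =
        ennreal (real (k choose i) * (fact i / ?h ^ i) * path_moment p (k - i))"
      by (simp only: ennreal_mult[symmetric] path_moment_nonneg mult_nonneg_nonneg of_nat_0_le_iff mult_ac)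
  qed
  also have "\<dots> = ennreal (path_moment (m # p) k)"
    unfolding path_moment.simps
    by (intro sum_ennreal mult_nonneg_nonneg divide_nonneg_nonneg zero_le_power harm_nonneg path_moment_nonneg) auto
  finally show ?case .
qed

section \<open>Averaging over the paths of the jump chain\<close>

lemma pmf_jump: "2 \<le> m \<Longrightarrow> pmf (jump m) i = jump_prob m i"
  unfolding jump_def by (rule pmf_embed_pmf[OF jump_valid])

lemma set_pmf_jump_subset: "2 \<le> m \<Longrightarrow> set_pmf (jump m) \<subseteq> {1..<m}"
  by (auto simp: set_pmf_eq pmf_jump jump_prob_def split: if_splits)

lemma jpath_le_1: "m \<le> 1 \<Longrightarrow> jpath m = return_pmf []"
  by (subst jpath.simps) simp

lemma jpath_ge_2: "2 \<le> m \<Longrightarrow> jpath m = bind_pmf (jump m) (\<lambda>i. map_pmf (Cons m) (jpath i))"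
  by (subst jpath.simps) simp

text \<open>The absorbing state 1 is never recorded in a path, so every entry has a positive rate;
  finite support makes every expectation over paths a finite sum.\<close>

lemma set_pmf_jpath: "finite (set_pmf (jpath m)) \<and> (\<forall>p\<in>set_pmf (jpath m). \<forall>i\<in>set p. 2 \<le> i)"
proof (induction m rule: less_induct)
  case (less m)
  show ?case
  proof (cases "m \<le> 1")
    case True
    then show ?thesis by (simp add: jpath_le_1)
  next
    case False
    have "finite (set_pmf (jump m))" "\<And>i. i \<in> set_pmf (jump m) \<Longrightarrow> i < m"
      using set_pmf_jump_subset[of m] False by (auto intro: finite_subset)
    then show ?thesis using False less by (auto simp: jpath_ge_2)
  qed
qed

lemma D_moment_expectation:
  "D_moment n k = measure_pmf.expectation (jpath n) (\<lambda>p. path_moment p k)"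
proof -
  have H: "holding_law \<in> measurable (measure_pmf (jpath n)) (subprob_algebra borel)"
    using holding_law_subprob by simp
  have bind: "(\<integral>\<^sup>+ x. f x \<partial>D_law n) = (\<integral>\<^sup>+ p. \<integral>\<^sup>+ x. f x \<partial>holding_law p \<partial>measure_pmf (jpath n))"
    if "f \<in> borel_measurable borel" for f
    unfolding D_law_def by (rule nn_integral_bind[OF that H])
  have sets: "sets (D_law n) = sets borel"
    unfolding D_law_def by (rule sets_bind) (simp_all add: sets_holding_law)
  have "(\<integral>\<^sup>+ x. indicator {..<0} x \<partial>D_law n) = 0"
    using holding_law_nonneg
    by (subst bind) (simp_all add: AE_borel_nonneg_iff[OF sets_holding_law])
  then have nonneg: "AE x in D_law n. 0 \<le> x" by (simp add: AE_borel_nonneg_iff[OF sets])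
  have meas: "(\<lambda>x. x ^ k) \<in> borel_measurable (D_law n)"
    by (subst measurable_cong_sets[OF sets refl]) simp
  have "D_moment n k = enn2real (\<integral>\<^sup>+ x. ennreal (x ^ k) \<partial>D_law n)"
    unfolding D_moment_def using nonneg meas
    by (intro integral_eq_nn_integral) (auto elim!: eventually_mono)
  also have "(\<integral>\<^sup>+ x. ennreal (x ^ k) \<partial>D_law n) =
      (\<integral>\<^sup>+ p. ennreal (path_moment p k) \<partial>measure_pmf (jpath n))"
    using set_pmf_jpath[of n]
    by (subst bind) (auto intro!: nn_integral_cong_AE simp: AE_measure_pmf_iff nn_integral_holding_law)
  also have "enn2real \<dots> = measure_pmf.expectation (jpath n) (\<lambda>p. path_moment p k)"
    by (intro integral_eq_nn_integral[symmetric]) (simp_all add: path_moment_nonneg)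
  finally show ?thesis .
qed

lemma D_moment_0: "D_moment n 0 = 1"
  by (simp add: D_moment_expectation path_moment_0)

lemma D_moment_1_Suc: "D_moment (Suc 0) (Suc k) = 0"
  by (simp add: D_moment_expectation jpath_le_1)

text \<open>First-step analysis: \<open>path_moment_Cons_Suc\<close> is averaged over the first
  jump. Its first term reassembles into the lower moment at the same state \<open>m\<close>.\<close>

lemma D_moment_Suc:
  assumes m: "2 \<le> m"
  shows "D_moment m (Suc k) = real (Suc k) / harm (m - 1) * D_moment m k +
    (\<Sum>i\<in>{1..<m}. jump_prob m i * D_moment i (Suc k))"
proof -
  have int: "integrable (measure_pmf (jpath i)) f" for i and f :: "nat list \<Rightarrow> real"
    by (rule integrable_measure_pmf_finite) (simp add: set_pmf_jpath)
  have E: "measure_pmf.expectation (jpath m) f =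
     (\<Sum>i\<in>{1..<m}. jump_prob m i * measure_pmf.expectation (jpath i) (\<lambda>p. f (m # p)))"
    for f :: "nat list \<Rightarrow> real"
    unfolding jpath_ge_2[OF m] using set_pmf_jump_subset[OF m]
    by (subst pmf_expectation_bind[of "{1..<m}"]) (simp_all add: set_pmf_jpath pmf_jump[OF m])
  have "D_moment m (Suc k) = (\<Sum>i\<in>{1..<m}. jump_prob m i * measure_pmf.expectation (jpath i)
      (\<lambda>p. real (Suc k) / harm (m - 1) * path_moment (m # p) k + path_moment p (Suc k)))"
    unfolding D_moment_expectation E path_moment_Cons_Suc ..
  also have "\<dots> = (\<Sum>i\<in>{1..<m}. real (Suc k) / harm (m - 1) * (jump_prob m i * measure_pmf.expectation (jpath i)
      (\<lambda>p. path_moment (m # p) k)) + jump_prob m i * D_moment i (Suc k))"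
    by (simp only: Bochner_Integration.integral_add[OF int int] integral_mult_right_zero D_moment_expectation)
       (simp only: distrib_left mult_ac)
  also have "\<dots> = real (Suc k) / harm (m - 1) * D_moment m k + (\<Sum>i\<in>{1..<m}. jump_prob m i * D_moment i (Suc k))"
    by (simp only: sum.distrib sum_distrib_left[symmetric] D_moment_expectation[of m] E[of "\<lambda>p. path_moment p k"])
  finally show ?thesis .
qed

text \<open>Both sides satisfy the same recursion over smaller states: the moments by
  \<open>D_moment_Suc\<close>, the sums by \<open>altsum_generator\<close>. The assumption is
  limited to \<open>1 <= n\<close> because for \<open>k = 0\<close> it fails at state 1, where the
  moment is 1 and the sum is empty.\<close>

lemma D_moment_eq_altsum_step:
  assumes prev: "\<And>n. 1 \<le> n \<Longrightarrow> D_moment (Suc n) k = fact k * altsum n (\<lambda>j. 1 / harm j ^ k)"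
  shows "D_moment (Suc n) (Suc k) = fact (Suc k) * altsum n (\<lambda>j. 1 / harm j ^ Suc k)"
proof (induction n rule: less_induct)
  case (less n)
  show ?case
  proof (cases "n = 0")
    case True
    then show ?thesis by (simp add: D_moment_1_Suc altsum_def)
  next
    case False
    let ?f = "\<lambda>j. 1 / harm j ^ Suc k :: real"
    have h: "harm n \<noteq> (0::real)" using harm_pos_nat[of n] False by (metis less_irrefl less_one not_le)
    \<comment> \<open>The sum is reindexed by the jump size \<open>l\<close>, which brings it to the
      form in \<open>altsum_generator\<close>.\<close>
    have "(\<Sum>i\<in>{1..<Suc n}. jump_prob (Suc n) i * D_moment i (Suc k)) =
        (\<Sum>l\<in>{1..n}. D_moment (Suc (n - l)) (Suc k) / (real l * harm n))"
      by (rule sum.reindex_bij_witness[where i = "\<lambda>l. Suc n - l" and j = "\<lambda>i. Suc n - i"])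
         (auto simp: jump_prob_def Suc_diff_le)
    also have "\<dots> = (\<Sum>l\<in>{1..n}. fact (Suc k) * (altsum (n - l) ?f / real l) / harm n)"
      by (intro sum.cong refl) (subst less, auto)
    also have "\<dots> = fact (Suc k) * (\<Sum>l\<in>{1..n}. altsum (n - l) ?f / real l) / harm n"
      by (simp only: sum_divide_distrib sum_distrib_left)
    also have "(\<Sum>l\<in>{1..n}. altsum (n - l) ?f / real l) = harm n * altsum n ?f - altsum n (\<lambda>j. harm j * ?f j)"
      using altsum_generator[of n ?f] by linarith
    also have "altsum n (\<lambda>j. harm j * ?f j) = altsum n (\<lambda>j. 1 / harm j ^ k)"
    proof (rule altsum_cong)
      fix s :: nat assume "1 \<le> s"
      from harm_pos_nat[OF this] have "harm s \<noteq> (0::real)" by (metis less_irrefl)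
      then show "harm s * ?f s = 1 / harm s ^ k" by (simp add: power_Suc)
    qed
    finally have *: "(\<Sum>i\<in>{1..<Suc n}. jump_prob (Suc n) i * D_moment i (Suc k)) =
       fact (Suc k) * (harm n * altsum n ?f - altsum n (\<lambda>j. 1 / harm j ^ k)) / harm n" .
    have "D_moment (Suc n) (Suc k) = real (Suc k) / harm n * (fact k * altsum n (\<lambda>j. 1 / harm j ^ k)) +
       fact (Suc k) * (harm n * altsum n ?f - altsum n (\<lambda>j. 1 / harm j ^ k)) / harm n"
      using D_moment_Suc[of "Suc n" k] False prev[of n] * by simp
    also have "\<dots> = fact (Suc k) * altsum n ?f"
      using h by (simp add: field_simps del: power_Suc)
    finally show ?thesis .
  qed
qed

lemma D_moment_eq_altsum:
  "D_moment (Suc n) (Suc k) = fact (Suc k) * altsum n (\<lambda>j. 1 / harm j ^ Suc k)"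
proof (induction k arbitrary: n)
  case 0
  have "D_moment (Suc n) 0 = fact 0 * altsum n (\<lambda>j. 1 / harm j ^ 0)" if "1 \<le> n" for n
    using altsum_inverse_power[OF that, of 0] by (simp add: D_moment_0)
  then show ?case by (rule D_moment_eq_altsum_step)
next
  case (Suc k)
  show ?case by (rule D_moment_eq_altsum_step) (rule Suc)
qed

theorem theorem12p1:
  fixes k :: nat
  assumes "k \<ge> 1"
  shows "\<exists>p :: real poly. degree p = k \<and> lead_coeff p = (6 / pi\<^sup>2) ^ k \<and>
           (\<lambda>n. D_moment n k - poly p (ln (real n))) \<in> O(\<lambda>n. ln (real n) ^ (k - 1) / real n)"
proof -
  obtain l where k: "k = Suc l" using assms by (cases k) auto
  \<comment> \<open>The factor \<open>k!\<close> of the moment formula cancels the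
    \<open>1 / k!\<close> from the complete homogeneous polynomial.\<close>
  have "log_poly k (fact k * ((6 / pi\<^sup>2) ^ k / fact k))
      (\<lambda>n. fact k * altsum (n - 1) (\<lambda>s. 1 / harm s ^ k))"
    by (intro log_poly_cmult log_poly_altsum_harm assms)
  then have "log_poly k ((6 / pi\<^sup>2) ^ k) (\<lambda>n. fact k * altsum (n - 1) (\<lambda>s. 1 / harm s ^ k))"
    by simp
  then have "log_poly k ((6 / pi\<^sup>2) ^ k) (\<lambda>n. D_moment n k)"
  proof (rule log_poly_cong)
    fix n :: nat assume "2 \<le> n"
    then show "fact k * altsum (n - 1) (\<lambda>s. 1 / harm s ^ k) = D_moment n k"
      using D_moment_eq_altsum[of "n - 1" l] by (simp add: k)
  qed
  then obtain p where p: "degree p \<le> k" "coeff p k = (6 / pi\<^sup>2) ^ k" and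
    O: "(\<lambda>n. D_moment n k - poly p (ln (real n))) \<in> O(\<lambda>n. ln (real n) ^ k / (real n * ln (real n)))"
    by (rule log_polyE)
  have "degree p = k" using p by (intro le_antisym le_degree) auto
  moreover have "(\<lambda>n. ln (real n) ^ k / (real n * ln (real n))) \<in> \<Theta>(\<lambda>n. ln (real n) ^ (k - 1) / real n)"
    using ln_ge_1_sequentially by (intro bigthetaI_cong) (auto elim!: eventually_mono simp: k)
  ultimately show ?thesis
    using p O by (intro exI[of _ p]) (simp add: landau_o.big.cong_bigtheta)
qed

end
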